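(* Let $n\ge3$, $\alpha,\alpha'\in\Bbbk^n$ and $\beta,\beta'\in(\Bbbk^\times)^n$. Then $\mathcal H(\alpha,\beta,0)\cong\mathcal H(\alpha',\beta',0)$ if and only if there exist $\lambda\in(\Bbbk^\times)^n$ and $k\in Q_0$ such that one of the following holds for all $i\in Q_0$ (indices mod $n$): (1) $\alpha'_i=\lambda_{i+k}\lambda_{i+k-1}^{-1}\alpha_{i+k}$ and $\beta'_i=\lambda_{i+k+1}\lambda_{i+k-1}^{-1}\beta_{i+k}$; or (2) $\alpha'_i=-\lambda_{n-i-k}^{-1}\lambda_{n-i-k-1}\beta_{n-i-k-1}^{-1}\alpha_{n-i-k-1}$ and $\beta'_i=\lambda_{n-i-k}^{-1}\lambda_{n-i-k-2}\beta_{n-i-k-1}^{-1}$.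
   Context: $\Bbbk$ is an algebraically closed field of characteristic zero. Indices mod $n$, $Q_0=\{0,\dots,n-1\}$. $Q$ is the quiver with vertices $Q_0$ and arrows $u_i:i\to i+1$, $d_i:i+1\to i$; paths are written left to right, $e_i$ is the trivial path at $i$. For $\alpha,\beta\in\Bbbk^n$, $\mathcal H(\alpha,\beta,0)$ is $\Bbbk Q$ modulo the relations $d_{i-1}u_{i-1}u_i=\alpha_iu_id_iu_i+\beta_iu_iu_{i+1}d_{i+1}$ and $d_id_{i-1}u_{i-1}=\alpha_id_iu_id_i+\beta_iu_{i+1}d_{i+1}d_i$ for all $i\in Q_0$. Isomorphism means isomorphism of $\Bbbk$-algebras. *)

theory Defs
  imports "HOL-Algebra.QuotRing" "HOL-Computational_Algebra.Polynomial"
begin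

datatype arr = U nat | D nat

definition md :: "nat \<Rightarrow> int \<Rightarrow> nat" where
  "md n j = nat (j mod int n)"

fun arr_idx :: "arr \<Rightarrow> nat" where
  "arr_idx (U i) = i" | "arr_idx (D i) = i"

fun src :: "nat \<Rightarrow> arr \<Rightarrow> nat" where
  "src n (U i) = i" | "src n (D i) = (i + 1) mod n"

fun tgt :: "nat \<Rightarrow> arr \<Rightarrow> nat" where
  "tgt n (U i) = (i + 1) mod n" | "tgt n (D i) = i"

text \<open>A path is a start vertex together with a list of arrows (written left to right);
  (v, []) is the trivial path e_v.\<close>
fun walk :: "nat \<Rightarrow> nat \<Rightarrow> arr list \<Rightarrow> bool" where
  "walk n v [] = (v < n)"
| "walk n v (a # as) = (v < n \<and> arr_idx a < n \<and> src n a = v \<and> walk n (tgt n a) as)"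

definition endv :: "nat \<Rightarrow> nat \<Rightarrow> arr list \<Rightarrow> nat" where
  "endv n v as = foldl (\<lambda>w a. tgt n a) v as"

type_synonym 'k pelem = "nat \<times> arr list \<Rightarrow> 'k"

text \<open>Path algebra kQ: finitely supported k-valued functions on the set of paths;
  product = concatenation of paths (zero if not composable).\<close>
definition pa_mult :: "nat \<Rightarrow> 'k::field pelem \<Rightarrow> 'k pelem \<Rightarrow> 'k pelem" where
  "pa_mult n f g = (\<lambda>(v, as). if walk n v as
      then (\<Sum>j\<in>{0..length as}. f (v, take j as) * g (endv n v (take j as), drop j as))
      else 0)"

definition pa_const :: "nat \<Rightarrow> 'k::field \<Rightarrow> 'k pelem" where
  "pa_const n c = (\<lambda>(v, as). if as = [] \<and> v < n then c else 0)"

definition path_alg :: "nat \<Rightarrow> ('k::field pelem) ring" where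
  "path_alg n = \<lparr> partial_object.carrier = {f. finite {p. f p \<noteq> 0} \<and> (\<forall>p. f p \<noteq> 0 \<longrightarrow> walk n (fst p) (snd p))},
                  monoid.mult = pa_mult n, monoid.one = pa_const n 1,
                  ring.zero = (\<lambda>_. 0), ring.add = (\<lambda>f g p. f p + g p) \<rparr>"

definition bas :: "nat \<times> arr list \<Rightarrow> 'k::field pelem" where
  "bas p = (\<lambda>q. if q = p then 1 else 0)"

definition pr :: "nat \<Rightarrow> nat \<Rightarrow> nat" where "pr n i = md n (int i - 1)"
definition sc :: "nat \<Rightarrow> nat \<Rightarrow> nat" where "sc n i = md n (int i + 1)"

definition rel1 :: "nat \<Rightarrow> (nat \<Rightarrow> 'k::field) \<Rightarrow> (nat \<Rightarrow> 'k) \<Rightarrow> nat \<Rightarrow> 'k pelem" where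
  "rel1 n \<alpha> \<beta> i = (\<lambda>p. bas (i, [D (pr n i), U (pr n i), U i]) p
      - \<alpha> i * bas (i, [U i, D i, U i]) p
      - \<beta> i * bas (i, [U i, U (sc n i), D (sc n i)]) p)"

definition rel2 :: "nat \<Rightarrow> (nat \<Rightarrow> 'k::field) \<Rightarrow> (nat \<Rightarrow> 'k) \<Rightarrow> nat \<Rightarrow> 'k pelem" where
  "rel2 n \<alpha> \<beta> i = (\<lambda>p. bas (sc n i, [D i, D (pr n i), U (pr n i)]) p
      - \<alpha> i * bas (sc n i, [D i, U i, D i]) p
      - \<beta> i * bas (sc n i, [U (sc n i), D (sc n i), D i]) p)"

definition H_ideal :: "nat \<Rightarrow> (nat \<Rightarrow> 'k::field) \<Rightarrow> (nat \<Rightarrow> 'k) \<Rightarrow> 'k pelem set" where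
  "H_ideal n \<alpha> \<beta> = genideal (path_alg n) ({rel1 n \<alpha> \<beta> i | i. i < n} \<union> {rel2 n \<alpha> \<beta> i | i. i < n})"

definition H_alg :: "nat \<Rightarrow> (nat \<Rightarrow> 'k::field) \<Rightarrow> (nat \<Rightarrow> 'k) \<Rightarrow> ('k pelem set) ring" where
  "H_alg n \<alpha> \<beta> = path_alg n Quot H_ideal n \<alpha> \<beta>"

definition H_scal :: "nat \<Rightarrow> (nat \<Rightarrow> 'k::field) \<Rightarrow> (nat \<Rightarrow> 'k) \<Rightarrow> 'k \<Rightarrow> 'k pelem set" where
  "H_scal n \<alpha> \<beta> c = H_ideal n \<alpha> \<beta> +>\<^bsub>path_alg n\<^esub> pa_const n c"

definition H_iso :: "nat \<Rightarrow> (nat \<Rightarrow> 'k::field) \<Rightarrow> (nat \<Rightarrow> 'k) \<Rightarrow> (nat \<Rightarrow> 'k) \<Rightarrow> (nat \<Rightarrow> 'k) \<Rightarrow> bool" where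
  "H_iso n \<alpha> \<beta> \<alpha>' \<beta>' \<longleftrightarrow> (\<exists>\<phi>. \<phi> \<in> ring_iso (H_alg n \<alpha> \<beta>) (H_alg n \<alpha>' \<beta>') \<and>
      (\<forall>c. \<phi> (H_scal n \<alpha> \<beta> c) = H_scal n \<alpha>' \<beta>' c))"

end

theory Submission
  imports Defs
begin

text \<open>
  Since the quiver has no loops, the characters of \<open>H(\<alpha>, \<beta>, 0)\<close> are exactly the \<open>n\<close> vertex evaluations, so an
  algebra isomorphism preserves the ideal \<open>J\<close> generated by the arrows and permutes the vertices modulo \<open>J\<close>.
  Looking modulo \<open>J\<^sup>2\<close>, this permutation is an automorphism of the \<open>n\<close>-cycle, hence a rotation or a
  reflection, and every arrow goes to a nonzero multiple of the corresponding arrow. As the relations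
  are homogeneous of degree 3, comparing coefficients modulo \<open>J\<^sup>4\<close> yields the two families of
  equations, with \<open>\<lambda>\<^sub>i\<close> the product of the scalars attached to the two arrows between \<open>i\<close> and \<open>i + 1\<close>.
  Conversely, rescaling the arrows \<open>u\<^sub>i\<close> by \<open>\<lambda>\<^sub>i\<close> along a rotation or reflection of the quiver is an
  automorphism of the path algebra that matches the defining relations up to scalars.
\<close>

subsection \<open>The path algebra\<close>

lemma md_less [simp]: "0 < n \<Longrightarrow> md n x < n"
  by (simp add: md_def nat_less_iff)

lemma int_md [simp]: "0 < n \<Longrightarrow> int (md n x) = x mod int n"
  by (simp add: md_def)

lemma md_of_nat [simp]: "i < n \<Longrightarrow> md n (int i) = i"
  by (simp add: md_def)

lemma md_eq_iff: "0 < n \<Longrightarrow> md n x = md n y \<longleftrightarrow> int n dvd x - y"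
  by (metis int_md md_def mod_eq_dvd_iff)

lemma md_mod_add [simp]: "md n (x mod int n + y) = md n (x + y)"
    "md n (y + x mod int n) = md n (y + x)"
    "md n (x mod int n) = md n x" "md n (y - x mod int n) = md n (y - x)"
    "md n (x mod int n - y) = md n (x - y)"
    "md n (y - (z + x mod int n)) = md n (y - (z + x))"
  by (simp_all add: md_def mod_simps)
    (metis diff_diff_add mod_diff_right_eq)

lemma md_add_self [simp]: "md n (int n + x) = md n x"
  by (simp add: md_def)

lemma md_diff_self: "md n (int n - x) = md n (- x)"
  using md_add_self[of n "- x"] by simp

text \<open>Links two index conventions: \<open>src\<close> and \<open>tgt\<close> use
  \<open>mod\<close> on naturals, whereas \<open>pr\<close>, \<open>sc\<close> and the final
  formulas use the integer residue \<open>md\<close>, which tolerates negative arguments.\<close>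

lemma Suc_mod_eq_md: "Suc i mod n = md n (int i + 1)"
  by (metis Suc_eq_plus1 md_def nat_int of_nat_1 of_nat_add of_nat_mod)

section \<open>Walks and their end points\<close>

lemma endv_Nil [simp]: "endv n v [] = v"
  and endv_Cons [simp]: "endv n v (a # as) = endv n (tgt n a) as"
  and endv_append [simp]: "endv n v (as @ bs) = endv n (endv n v as) bs"
  by (simp_all add: endv_def)

lemma src_tgt_less [simp]: "arr_idx a < n \<Longrightarrow> src n a < n" "arr_idx a < n \<Longrightarrow> tgt n a < n"
  by (cases a; simp)+

lemma walk_start: "walk n v as \<Longrightarrow> v < n"
  by (cases as) auto

lemma walk_append: "walk n v (as @ bs) \<longleftrightarrow> walk n v as \<and> walk n (endv n v as) bs"
  by (induction as arbitrary: v) (auto dest: walk_start)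

lemma walk_endv: "walk n v as \<Longrightarrow> endv n v as < n"
  using walk_append[of n v as "[]"] by simp

lemma walk_take_drop:
  assumes "walk n v as"
  shows "walk n v (take j as)" "walk n (endv n v (take j as)) (drop j as)"
  using assms walk_append[of n v "take j as" "drop j as"] by auto

section \<open>The path algebra as a ring of finitely supported functions\<close>

abbreviation "pcarrier n \<equiv> carrier (path_alg n)"

lemma path_alg_simps [simp]:
  "monoid.mult (path_alg n) = pa_mult n" "one (path_alg n) = pa_const n 1"
  "zero (path_alg n) = (\<lambda>_. 0)" "add (path_alg n) = (\<lambda>f g p. f p + g p)"
  by (simp_all add: path_alg_def)

lemma pcarrier_iff: "f \<in> pcarrier n \<longleftrightarrow>
    finite {p. f p \<noteq> 0} \<and> (\<forall>p. f p \<noteq> 0 \<longrightarrow> walk n (fst p) (snd p))"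
  by (simp add: path_alg_def)

lemma pcarrier_zero [simp]: "(\<lambda>_. 0) \<in> pcarrier n"
  by (simp add: pcarrier_iff)

lemma pcarrier_not_walk: "f \<in> pcarrier n \<Longrightarrow> \<not> walk n v as \<Longrightarrow> f (v, as) = 0"
  by (auto simp: pcarrier_iff)

lemma pcarrier_add:
  assumes "f \<in> pcarrier n" "g \<in> pcarrier n" shows "(\<lambda>p. f p + g p) \<in> pcarrier n"
proof -
  have "{p. f p + g p \<noteq> 0} \<subseteq> {p. f p \<noteq> 0} \<union> {p. g p \<noteq> 0}" by auto
  with assms show ?thesis
    unfolding pcarrier_iff by (metis (mono_tags, lifting) add.right_neutral finite_Un finite_subset)
qed

lemma pcarrier_scale:
  assumes "f \<in> pcarrier n" shows "(\<lambda>p. c * f p) \<in> pcarrier n"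
proof -
  have "{p. c * f p \<noteq> 0} \<subseteq> {p. f p \<noteq> 0}" by auto
  with assms show ?thesis
    unfolding pcarrier_iff by (metis (mono_tags, lifting) finite_subset mult_zero_right)
qed

lemma pcarrier_const [simp]: "pa_const n c \<in> pcarrier n"
proof -
  have "{p. pa_const n c p \<noteq> 0} \<subseteq> (\<lambda>v. (v, [])) ` {..<n}"
    by (auto simp: pa_const_def split: if_splits)
  then have "finite {p. pa_const n c p \<noteq> 0}" by (rule finite_subset) simp
  then show ?thesis by (auto simp: pcarrier_iff pa_const_def split: if_splits)
qed

lemma pcarrier_bas [simp]: "walk n v as \<Longrightarrow> bas (v, as) \<in> pcarrier n"
  by (auto simp: pcarrier_iff bas_def)

lemma pcarrier_mult:
  assumes f: "f \<in> pcarrier n" and g: "g \<in> pcarrier n" shows "pa_mult n f g \<in> pcarrier n"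
proof -
  \<comment> \<open>A nonzero value of the product forces a cut of the path into one from the
    support of \<open>f\<close> and one from the support of \<open>g\<close>, so the support lies in
    the image of a finite set under concatenation.\<close>
  let ?S = "(\<lambda>((v, as), (w, bs)). (v, as @ bs)) ` ({p. f p \<noteq> 0} \<times> {p. g p \<noteq> 0})"
  have "p \<in> ?S" if "pa_mult n f g p \<noteq> 0" for p
  proof -
    obtain v as where p: "p = (v, as)" by force
    with that obtain j where "f (v, take j as) * g (endv n v (take j as), drop j as) \<noteq> 0"
      by (auto simp: pa_mult_def split: if_splits elim: sum.not_neutral_contains_not_neutral)
    then show ?thesis
      by (intro image_eqI[of _ _ "((v, take j as), (endv n v (take j as), drop j as))"]) (auto simp: p)
  qed
  then have "{p. pa_mult n f g p \<noteq> 0} \<subseteq> ?S" by blast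
  moreover have "finite ?S" using f g by (simp add: pcarrier_iff)
  ultimately show ?thesis
    by (auto simp: pcarrier_iff pa_mult_def split: if_splits intro: finite_subset)
qed

lemma pa_mult_apply: "walk n v as \<Longrightarrow> pa_mult n f g (v, as) =
    (\<Sum>j\<le>length as. f (v, take j as) * g (endv n v (take j as), drop j as))"
  by (simp add: pa_mult_def atLeast0AtMost)

text \<open>Both bracketings sum over all cuts of the path into three consecutive pieces.\<close>

lemma pa_mult_assoc: "pa_mult n (pa_mult n f g) h = pa_mult n f (pa_mult n g h)"
proof (rule ext, clarify)
  fix v as
  show "pa_mult n (pa_mult n f g) h (v, as) = pa_mult n f (pa_mult n g h) (v, as)"
  proof (cases "walk n v as")
    case False
    then show ?thesis by (simp add: pa_mult_def)
  next
    case w: True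
    \<comment> \<open>\<open>i\<close> and \<open>l\<close> are the lengths of the first two pieces;
      the third is what remains.\<close>
    define G where "G i l = f (v, take i as) * g (endv n v (take i as), take l (drop i as))
      * h (endv n v (take (i + l) as), drop (i + l) as)" for i l
    let ?L = "length as"
    have "pa_mult n (pa_mult n f g) h (v, as) = (\<Sum>j\<le>?L. \<Sum>i\<le>j. G i (j - i))"
      unfolding pa_mult_apply[OF w] sum_distrib_right
    proof (rule sum.cong[OF refl])
      fix j assume "j \<in> {..?L}"
      then show "pa_mult n f g (v, take j as) * h (endv n v (take j as), drop j as) = (\<Sum>i\<le>j. G i (j - i))"
        using w by (auto simp: pa_mult_apply walk_take_drop sum_distrib_right min_absorb1 min_absorb2
          G_def drop_take intro!: sum.cong)
    qed
    \<comment> \<open>The left bracketing fixes the joint length \<open>j\<close> of the first two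
      pieces; slicing the same triangle by \<open>i\<close> gives the right one.\<close>
    also have "\<dots> = (\<Sum>(i,l)\<in>{(i,l). i + l \<le> ?L}. G i l)"
      by (simp add: sum.triangle_reindex_eq)
    also have "{(i,l). i + l \<le> ?L} = (SIGMA i:{..?L}. {..?L - i})" by auto
    also have "(\<Sum>(i,l)\<in>(SIGMA i:{..?L}. {..?L - i}). G i l) = (\<Sum>i\<le>?L. \<Sum>l\<le>?L - i. G i l)"
      by (simp add: sum.Sigma)
    also have "\<dots> = pa_mult n f (pa_mult n g h) (v, as)"
      using w by (simp add: pa_mult_apply walk_take_drop sum_distrib_left G_def take_add mult.assoc
          add.commute cong: sum.cong)
    finally show ?thesis .
  qed
qed

text \<open>The constant lives on trivial paths, so of all cuts only the one at position 0
  contributes.\<close>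

lemma pa_mult_const_left: "f \<in> pcarrier n \<Longrightarrow> pa_mult n (pa_const n c) f = (\<lambda>p. c * f p)"
proof (rule ext, clarify)
  fix v as assume f: "f \<in> pcarrier n"
  show "pa_mult n (pa_const n c) f (v, as) = c * f (v, as)"
  proof (cases "walk n v as")
    case False
    then show ?thesis using f by (simp add: pa_mult_def pcarrier_not_walk)
  next
    case True
    have "pa_mult n (pa_const n c) f (v, as) = (\<Sum>j\<le>length as. if j = 0 then c * f (v, as) else 0)"
      unfolding pa_mult_apply[OF True]
      using walk_start[OF True] by (intro sum.cong) (auto simp: pa_const_def)
    then show ?thesis by simp
  qed
qed

lemma pa_mult_const_right: "f \<in> pcarrier n \<Longrightarrow> pa_mult n f (pa_const n c) = (\<lambda>p. f p * c)"
proof (rule ext, clarify)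
  fix v as assume f: "f \<in> pcarrier n"
  show "pa_mult n f (pa_const n c) (v, as) = f (v, as) * c"
  proof (cases "walk n v as")
    case False
    then show ?thesis using f by (simp add: pa_mult_def pcarrier_not_walk)
  next
    case True
    have "pa_mult n f (pa_const n c) (v, as)
        = (\<Sum>j\<le>length as. if j = length as then f (v, as) * c else 0)"
      unfolding pa_mult_apply[OF True]
      using walk_endv[OF True] by (intro sum.cong) (auto simp: pa_const_def)
    then show ?thesis by simp
  qed
qed

lemma pa_mult_distrib:
  "pa_mult n (\<lambda>p. f p + g p) h = (\<lambda>p. pa_mult n f h p + pa_mult n g h p)"
  "pa_mult n h (\<lambda>p. f p + g p) = (\<lambda>p. pa_mult n h f p + pa_mult n h g p)"
  by (auto simp: pa_mult_def algebra_simps sum.distrib)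

lemma ring_path_alg: "ring (path_alg n)"
proof (intro ringI abelian_groupI monoidI)
  fix x assume x: "x \<in> pcarrier n"
  have "(\<lambda>p. -1 * x p) \<in> pcarrier n" by (rule pcarrier_scale[OF x])
  then show "\<exists>y\<in>pcarrier n. y \<oplus>\<^bsub>path_alg n\<^esub> x = \<zero>\<^bsub>path_alg n\<^esub>"
    by (intro bexI[of _ "\<lambda>p. -1 * x p"]) auto
qed (simp_all add: pcarrier_add pcarrier_mult pa_mult_assoc pa_mult_const_left pa_mult_const_right
    pa_mult_distrib algebra_simps)

lemma pa_minus: "f \<in> pcarrier n \<Longrightarrow> \<ominus>\<^bsub>path_alg n\<^esub> f = (\<lambda>p. - f p)"
proof -
  interpret ring "path_alg n" by (rule ring_path_alg)
  assume f: "f \<in> pcarrier n"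
  then have "(\<lambda>p. - f p) \<in> pcarrier n" using pcarrier_scale[OF f, of "-1"] by simp
  with f show ?thesis by (intro minus_equality) auto
qed

text \<open>Rebuilds \<open>f\<close> by adding one path of its support at a time, through the
  truncations \<open>?f B\<close>. The predicate \<open>S\<close> hands a restriction on the support
  to each added path; \<open>ex_coef_nonzero\<close> uses it to exclude trivial paths.\<close>

lemma pcarrier_induct_support [consumes 2, case_names zero add]:
  assumes f: "f \<in> pcarrier n" and S: "\<forall>p. f p \<noteq> 0 \<longrightarrow> S p"
    and "P (\<lambda>_. 0)"
    and step: "\<And>g c v as. g \<in> pcarrier n \<Longrightarrow> P g \<Longrightarrow> walk n v as \<Longrightarrow> S (v, as)
      \<Longrightarrow> P (\<lambda>p. g p + c * bas (v, as) p)"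
  shows "P f"
proof -
  let ?f = "\<lambda>B p. if p \<in> B then f p else 0"
  have "P (?f B) \<and> ?f B \<in> pcarrier n" if "finite B" "B \<subseteq> {p. f p \<noteq> 0}" for B
    using that
  proof (induction B rule: finite_induct)
    case empty
    then show ?case using assms by simp
  next
    case (insert q B)
    obtain v as where q: "q = (v, as)" by force
    have eq: "?f (insert q B) = (\<lambda>p. ?f B p + f q * bas (v, as) p)"
      using insert.hyps by (auto simp: bas_def q)
    have "f q \<noteq> 0" using insert.prems by auto
    then have "walk n v as" "S (v, as)" using f S by (auto simp: pcarrier_iff q)
    with insert show ?case unfolding eq
      by (auto intro!: step pcarrier_add pcarrier_scale)
  qed
  from this[of "{p. f p \<noteq> 0}"] have "P (?f {p. f p \<noteq> 0})" using f by (simp add: pcarrier_iff)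
  moreover have "?f {p. f p \<noteq> 0} = f" by auto
  ultimately show ?thesis by simp
qed

lemma pcarrier_induct [consumes 1, case_names zero add]:
  assumes "f \<in> pcarrier n" "P (\<lambda>_. 0)"
    and "\<And>g c v as. g \<in> pcarrier n \<Longrightarrow> P g \<Longrightarrow> walk n v as \<Longrightarrow> P (\<lambda>p. g p + c * bas (v, as) p)"
  shows "P f"
  using pcarrier_induct_support[of f n "\<lambda>_. True" P] assms by blast

text \<open>Of all cuts of a path, only the one after \<open>length as\<close> arrows can recover
  both factors.\<close>

lemma pa_mult_bas:
  assumes "walk n v as" "walk n w bs"
  shows "pa_mult n (bas (v, as)) (bas (w, bs))
    = ((if endv n v as = w then bas (v, as @ bs) else (\<lambda>_. 0)) :: 'k::field pelem)"
proof (rule ext, clarify)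
  fix x cs
  show "pa_mult n (bas (v, as)) (bas (w, bs)) (x, cs)
      = ((if endv n v as = w then bas (v, as @ bs) else (\<lambda>_. 0)) (x, cs :: arr list) :: 'k)"
  proof (cases "walk n x cs")
    case False
    then show ?thesis using assms by (auto simp: pa_mult_def bas_def walk_append)
  next
    case True
    have "pa_mult n (bas (v, as)) (bas (w, bs)) (x, cs) = (\<Sum>j\<le>length cs. if j = length as then
       (if endv n v as = w then bas (v, as @ bs) else (\<lambda>_. 0)) (x, cs) else 0)"
      unfolding pa_mult_apply[OF True]
    proof (rule sum.cong[OF refl])
      fix j assume j: "j \<in> {..length cs}"
      have "take j cs = as \<and> drop j cs = bs \<longleftrightarrow> j = length as \<and> cs = as @ bs"
        using j by (metis append_eq_conv_conj atMost_iff length_take min.absorb2)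
      then have *: "take j cs = as \<Longrightarrow> drop j cs = bs \<Longrightarrow> j = length as \<and> cs = as @ bs"
        and **: "j = length as \<Longrightarrow> cs = as @ bs \<Longrightarrow> take j cs = as \<and> drop j cs = bs" by blast+
      show "bas (v, as) (x, take j cs) * bas (w, bs) (endv n x (take j cs), drop j cs) =
         (if j = length as then (if endv n v as = w then bas (v, as @ bs) else (\<lambda>_. 0)) (x, cs) else 0)"
      proof (cases "take j cs = as \<and> drop j cs = bs")
        case True
        with * show ?thesis by (auto simp: bas_def)
      next
        case False
        then have "bas (v, as) (x, take j cs) * bas (w, bs) (endv n x (take j cs), drop j cs) = (0::'k)"
          by (auto simp: bas_def)
        moreover have "\<not> (j = length as \<and> cs = as @ bs)" using False ** by blast
        ultimately show ?thesis by (auto simp: bas_def)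
      qed
    qed
    also have "\<dots> = (if endv n v as = w then bas (v, as @ bs) else (\<lambda>_. 0)) (x, cs)"
      by (auto simp: bas_def)
    finally show ?thesis .
  qed
qed

subsection \<open>The ideal of relations and its low degree part\<close>

lemma pr_sc_less [simp]: "0 < n \<Longrightarrow> pr n i < n" "0 < n \<Longrightarrow> sc n i < n"
  by (simp_all add: pr_def sc_def)

lemma Suc_pr_mod [simp]: "i < n \<Longrightarrow> Suc (pr n i) mod n = i"
  by (simp add: Suc_mod_eq_md pr_def)

lemma Suc_mod_sc [simp]: "Suc i mod n = sc n i"
  by (simp add: Suc_mod_eq_md sc_def)

lemma sc_pr [simp]: "i < n \<Longrightarrow> sc n (pr n i) = i"
  by (metis Suc_mod_sc Suc_pr_mod)

lemma pr_sc [simp]: "i < n \<Longrightarrow> pr n (sc n i) = i"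
  by (simp add: pr_def sc_def)

text \<open>Common shape of \<open>rel1\<close> and \<open>rel2\<close>, with the three cubic paths
  as parameters, so that the carrier condition and the behaviour under \<open>twist\<close> are
  computed once for both families.\<close>

definition rel3 :: "'k \<Rightarrow> 'k \<Rightarrow> nat \<times> arr list \<Rightarrow> nat \<times> arr list \<Rightarrow> nat \<times> arr list \<Rightarrow> 'k::field pelem" where
  "rel3 a b p q r = (\<lambda>x. bas p x - a * bas q x - b * bas r x)"

lemma rel1_rel3: "rel1 n \<alpha> \<beta> i = rel3 (\<alpha> i) (\<beta> i) (i, [D (pr n i), U (pr n i), U i])
    (i, [U i, D i, U i]) (i, [U i, U (sc n i), D (sc n i)])"
  by (simp add: rel1_def rel3_def)

lemma rel2_rel3: "rel2 n \<alpha> \<beta> i = rel3 (\<alpha> i) (\<beta> i) (sc n i, [D i, D (pr n i), U (pr n i)])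
    (sc n i, [D i, U i, D i]) (sc n i, [U (sc n i), D (sc n i), D i])"
  by (simp add: rel2_def rel3_def)

lemma pcarrier_rel3:
  assumes "walk n v as" "walk n w bs" "walk n x cs"
  shows "rel3 a b (v, as) (w, bs) (x, cs) \<in> pcarrier n"
proof -
  have "(\<lambda>p. (bas (v, as) p + (- a) * bas (w, bs) p) + (- b) * bas (x, cs) p) \<in> pcarrier n"
    using assms by (intro pcarrier_add pcarrier_scale pcarrier_bas)
  then show ?thesis by (simp add: rel3_def)
qed

lemma pcarrier_rel:
  assumes "i < n" shows "rel1 n \<alpha> \<beta> i \<in> pcarrier n" "rel2 n \<alpha> \<beta> i \<in> pcarrier n"
  using assms by (auto simp: rel1_rel3 rel2_rel3 intro!: pcarrier_rel3)

text \<open>Applied to \<open>f\<close> in \<open>low_ideal\<close> and paths of length at most 3: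
  proper initial segments are too short for \<open>f\<close>, so the other factor enters only
  through its value at the end vertex.\<close>

lemma pa_mult_low_left:
  assumes "walk n v as" "\<And>j. j < length as \<Longrightarrow> f (v, take j as) = 0"
  shows "pa_mult n f g (v, as) = f (v, as) * g (endv n v as, [])"
proof -
  have "pa_mult n f g (v, as)
      = (\<Sum>j\<le>length as. if j = length as then f (v, as) * g (endv n v as, []) else 0)"
    unfolding pa_mult_apply[OF assms(1)] using assms(2) by (intro sum.cong) auto
  then show ?thesis by simp
qed

lemma pa_mult_low_right:
  assumes "walk n v as" "\<And>j w. 0 < j \<Longrightarrow> g (w, drop j as) = 0"
  shows "pa_mult n f g (v, as) = f (v, []) * g (v, as)"
proof -
  have "pa_mult n f g (v, as) = (\<Sum>j\<le>length as. if j = 0 then f (v, []) * g (v, as) else 0)"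
    unfolding pa_mult_apply[OF assms(1)] using assms(2) by (intro sum.cong) auto
  then show ?thesis by simp
qed

text \<open>Linear conditions satisfied by the coefficients of elements of \<^const>\<open>H_ideal\<close> along paths
  of length at most 3. For \<open>n = 4\<close> there are further paths of length 3 with the same end points,
  but their coefficients are not needed.\<close>
definition low_ideal :: "nat \<Rightarrow> (nat \<Rightarrow> 'k::field) \<Rightarrow> (nat \<Rightarrow> 'k) \<Rightarrow> 'k pelem set" where
  "low_ideal n \<alpha> \<beta> = {f \<in> pcarrier n. (\<forall>v as. length as \<le> 2 \<longrightarrow> f (v, as) = 0) \<and>
     (\<forall>i<n. f (i, [U i, D i, U i]) = - \<alpha> i * f (i, [D (pr n i), U (pr n i), U i])
        \<and> f (i, [U i, U (sc n i), D (sc n i)]) = - \<beta> i * f (i, [D (pr n i), U (pr n i), U i])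
        \<and> f (sc n i, [D i, U i, D i]) = - \<alpha> i * f (sc n i, [D i, D (pr n i), U (pr n i)])
        \<and> f (sc n i, [U (sc n i), D (sc n i), D i]) = - \<beta> i * f (sc n i, [D i, D (pr n i), U (pr n i)]))}"

lemma low_idealD:
  assumes "f \<in> low_ideal n \<alpha> \<beta>" "i < n"
  shows "f (i, [U i, D i, U i]) = - \<alpha> i * f (i, [D (pr n i), U (pr n i), U i])"
    "f (i, [U i, U (sc n i), D (sc n i)]) = - \<beta> i * f (i, [D (pr n i), U (pr n i), U i])"
    "f (sc n i, [D i, U i, D i]) = - \<alpha> i * f (sc n i, [D i, D (pr n i), U (pr n i)])"
    "f (sc n i, [U (sc n i), D (sc n i), D i]) = - \<beta> i * f (sc n i, [D i, D (pr n i), U (pr n i)])"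
  using assms unfolding low_ideal_def by blast+

text \<open>On paths of length at most 3, multiplication rescales the coefficients of such an
  element by a scalar that depends only on the start or the end vertex. Each defining condition
  relates parallel paths, which are rescaled alike, so it survives.\<close>

lemma ideal_low_ideal:
  fixes \<alpha> \<beta> :: "nat \<Rightarrow> 'a::field"
  shows "ideal (low_ideal n \<alpha> \<beta>) (path_alg n)"
proof -
  interpret ring "path_alg n" by (rule ring_path_alg)
  let ?T = "low_ideal n \<alpha> \<beta>"
  have 0: "f (v, take j as) = 0" if "f \<in> ?T" "j < length as" "length as \<le> 3" for f v as j
    using that by (auto simp: low_ideal_def)
  have 1: "f (v, drop j as) = 0" if "f \<in> ?T" "0 < j" "length as \<le> 3" for f v as j
    using that by (auto simp: low_ideal_def)
  have L: "pa_mult n f g (v, as) = f (v, as) * g (endv n v as, [])"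
    if "f \<in> ?T" "length as \<le> 3" "walk n v as" for f g :: "'a pelem" and v as
    using that 0 by (intro pa_mult_low_left) auto
  have R: "pa_mult n g f (v, as) = g (v, []) * f (v, as)"
    if "f \<in> ?T" "length as \<le> 3" "walk n v as" for f g :: "'a pelem" and v as
    using that 1 by (intro pa_mult_low_right) auto
  have sub: "f \<in> pcarrier n" if "f \<in> ?T" for f using that by (simp add: low_ideal_def)
  have short: "f (v, as) = 0" if "f \<in> ?T" "length as \<le> 2" for f v as
    using that by (simp add: low_ideal_def)
  show ?thesis
  proof (rule idealI[OF ring_path_alg])
    show "subgroup ?T (add_monoid (path_alg n))"
    proof (unfold_locales, goal_cases)
      case (4 f)
      then have "inv\<^bsub>add_monoid (path_alg n)\<^esub> f = \<ominus>\<^bsub>path_alg n\<^esub> f" by (simp add: a_inv_def)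
      also have "\<dots> = (\<lambda>p. (-1) * f p)" using pa_minus[OF sub[OF 4]] by simp
      finally show ?case
        using 4 pcarrier_scale[OF sub[OF 4], of "-1"] unfolding low_ideal_def by simp
    qed (auto simp: low_ideal_def pcarrier_add algebra_simps)
  next
    fix f g :: "'a pelem" assume f: "f \<in> ?T" and g: "g \<in> carrier (path_alg n)"
    have s: "pa_mult n f g (v, as) = 0" "pa_mult n g f (v, as) = 0" if "length as \<le> 2" for v as
    proof -
      have "pa_mult n f g (v, as) = 0 \<and> pa_mult n g f (v, as) = 0"
      proof (cases "walk n v as")
        case True
        then show ?thesis using that f by (simp add: L R short)
      next
        case False
        then show ?thesis by (simp add: pa_mult_def)
      qed
      then show "pa_mult n f g (v, as) = 0" "pa_mult n g f (v, as) = 0" by auto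
    qed
    show "g \<otimes>\<^bsub>path_alg n\<^esub> f \<in> ?T"
      using f g s sub[OF f] unfolding low_ideal_def path_alg_simps
      by (auto simp: pcarrier_mult R[OF f])
    show "f \<otimes>\<^bsub>path_alg n\<^esub> g \<in> ?T"
      using f g s sub[OF f] unfolding low_ideal_def path_alg_simps
      by (auto simp: pcarrier_mult L[OF f])
  qed
qed

lemma rels_in_low_ideal:
  assumes "i < n" shows "rel1 n \<alpha> \<beta> i \<in> low_ideal n \<alpha> \<beta>" "rel2 n \<alpha> \<beta> i \<in> low_ideal n \<alpha> \<beta>"
  using pcarrier_rel[OF assms] unfolding low_ideal_def
  by (auto simp: rel1_def rel2_def bas_def)

abbreviation "rels n \<alpha> \<beta> \<equiv> {rel1 n \<alpha> \<beta> i | i. i < n} \<union> {rel2 n \<alpha> \<beta> i | i. i < n}"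

lemma rels_carrier: "rels n \<alpha> \<beta> \<subseteq> pcarrier n"
  by (auto simp: pcarrier_rel)

lemma ideal_H_ideal: "ideal (H_ideal n \<alpha> \<beta>) (path_alg n)"
  unfolding H_ideal_def by (intro ring.genideal_ideal ring_path_alg rels_carrier)

lemma rels_subset_H_ideal: "rels n \<alpha> \<beta> \<subseteq> H_ideal n \<alpha> \<beta>"
  unfolding H_ideal_def by (intro ring.genideal_self ring_path_alg rels_carrier)

lemma H_ideal_minimal: "ideal J (path_alg n) \<Longrightarrow> rels n \<alpha> \<beta> \<subseteq> J \<Longrightarrow> H_ideal n \<alpha> \<beta> \<subseteq> J"
  unfolding H_ideal_def by (intro ring.genideal_minimal ring_path_alg)

text \<open>Turns membership in an ideal given by generators into explicit coefficient conditions: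
  vanishing up to degree 2 and linear equations in degree 3.\<close>

lemma H_ideal_subset_low_ideal: "H_ideal n \<alpha> \<beta> \<subseteq> low_ideal n \<alpha> \<beta>"
  by (intro H_ideal_minimal ideal_low_ideal) (auto intro: rels_in_low_ideal)

section \<open>The quotient algebra and its projection\<close>

definition proj :: "nat \<Rightarrow> (nat \<Rightarrow> 'k::field) \<Rightarrow> (nat \<Rightarrow> 'k) \<Rightarrow> 'k pelem \<Rightarrow> 'k pelem set" where
  "proj n \<alpha> \<beta> f = H_ideal n \<alpha> \<beta> +>\<^bsub>path_alg n\<^esub> f"

lemma proj_hom: "proj n \<alpha> \<beta> \<in> ring_hom (path_alg n) (H_alg n \<alpha> \<beta>)"
  using ideal.rcos_ring_hom[OF ideal_H_ideal] by (simp add: H_alg_def proj_def[abs_def])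

lemma ring_H_alg: "ring (H_alg n \<alpha> \<beta>)"
  unfolding H_alg_def by (rule ideal.quotient_is_ring[OF ideal_H_ideal])

lemma proj_eq_iff:
  assumes "f \<in> pcarrier n" "g \<in> pcarrier n"
  shows "proj n \<alpha> \<beta> f = proj n \<alpha> \<beta> g \<longleftrightarrow> (\<lambda>p. f p - g p) \<in> H_ideal n \<alpha> \<beta>"
proof -
  have "f \<ominus>\<^bsub>path_alg n\<^esub> g = (\<lambda>p. f p - g p)"
    using pa_minus[OF assms(2)] by (simp add: a_minus_def)
  then show ?thesis
    using ring.quotient_eq_iff_same_a_r_cos[OF ring_path_alg ideal_H_ideal assms]
    by (simp add: proj_def)
qed

lemma proj_surj: "X \<in> carrier (H_alg n \<alpha> \<beta>) \<Longrightarrow> \<exists>f\<in>pcarrier n. X = proj n \<alpha> \<beta> f"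
  by (auto simp: H_alg_def proj_def FactRing_def A_RCOSETS_def')

lemma H_scal_proj: "H_scal n \<alpha> \<beta> c = proj n \<alpha> \<beta> (pa_const n c)"
  by (simp add: H_scal_def proj_def)

subsection \<open>Isomorphisms induce dihedral symmetries of the quiver\<close>

text \<open>Unit steps along the cycle cannot turn back, since a value would then recur after two
  steps, against injectivity. Hence the direction of the first step persists and decides between
  rotation and reflection.\<close>

lemma dihedral:
  assumes n: "3 \<le> n" and inj: "inj_on s {..<n}" and less: "\<And>j. j < n \<Longrightarrow> s j < n"
    and step: "\<And>j. j < n \<Longrightarrow> s (sc n j) = md n (int (s j) + 1) \<or> s (sc n j) = md n (int (s j) - 1)"
  shows "\<exists>k<n. (\<forall>j<n. s j = md n (int j + int k)) \<or> (\<forall>j<n. s j = md n (int n - int j - int k))"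
proof -
  have sc: "sc n j = Suc j" if "Suc j < n" for j
    using that Suc_mod_sc[of j n] by (simp del: Suc_mod_sc)
  have no_back: False if "Suc (Suc j) < n" "s (Suc (Suc j)) = s j" for j
    using inj_onD[OF inj that(2)] that(1) by simp
  have st: "s (Suc j) = md n (int (s j) + 1) \<or> s (Suc j) = md n (int (s j) - 1)" if "Suc j < n" for j
    using step[of j] sc[OF that] that by simp
  consider "s 1 = md n (int (s 0) + 1)" | "s 1 = md n (int (s 0) - 1)"
    using st[of 0] n by auto
  then show ?thesis
  proof cases
    case 1
    have "j < n \<Longrightarrow> s j = md n (int j + int (s 0))" for j
    \<comment> \<open>Strong induction, since excluding a turn uses the two preceding
      values.\<close>
    proof (induction j rule: less_induct)
      case (less j)
      consider "j = 0" | "j = 1" | i where "j = Suc (Suc i)" by (metis One_nat_def not0_implies_Suc)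
      then show ?case
      proof cases
        case 1
        then show ?thesis using assms(3)[of 0] n by simp
      next
        case 2
        then show ?thesis using \<open>s 1 = _\<close> by (simp add: add.commute)
      next
        case 3
        then have "Suc i < j" "i < j" "Suc i < n" "i < n" using less(2) by simp_all
        then have i: "s (Suc i) = md n (int (Suc i) + int (s 0))" "s i = md n (int i + int (s 0))"
          using less(1) by blast+
        \<comment> \<open>Equality would bring \<open>s j\<close> back to
          \<open>s i\<close>.\<close>
        then have "s j \<noteq> md n (int (s (Suc i)) - 1)" using no_back[of i] 3 less(2) n by auto
        then have "s j = md n (int (s (Suc i)) + 1)" using st[of "Suc i"] 3 less(2) by auto
        also have "\<dots> = md n (int (Suc i) + int (s 0) + 1)"
          using n i(1) by (simp only: int_md md_mod_add)
        also have "int (Suc i) + int (s 0) + 1 = int j + int (s 0)" using 3 by simp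
        finally show ?thesis .
      qed
    qed
    moreover have "s 0 < n" using less n by simp
    ultimately show ?thesis by blast
  next
    case 2
    \<comment> \<open>Reflections are written with \<open>n - j - k\<close>, so \<open>k\<close> has
      to represent \<open>- s 0\<close> modulo \<open>n\<close>.\<close>
    define k where "k = md n (- int (s 0))"
    have k: "md n (int n - int j - int k) = md n (int (s 0) - int j)" for j
    proof -
      have "md n (int n - int j - int k) = md n (int n - int j - - int (s 0))"
        using n unfolding k_def by (simp only: int_md md_mod_add)
      also have "int n - int j - - int (s 0) = int n + (int (s 0) - int j)" by simp
      finally show ?thesis by (simp only: md_add_self)
    qed
    have "j < n \<Longrightarrow> s j = md n (int (s 0) - int j)" for j
    proof (induction j rule: less_induct)
      case (less j)
      consider "j = 0" | "j = 1" | i where "j = Suc (Suc i)" by (metis One_nat_def not0_implies_Suc)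
      then show ?case
      proof cases
        case 1
        then show ?thesis using assms(3)[of 0] n by simp
      next
        case 2
        then show ?thesis using \<open>s 1 = _\<close> by simp
      next
        case 3
        then have "Suc i < j" "i < j" "Suc i < n" "i < n" using less(2) by simp_all
        then have i: "s (Suc i) = md n (int (s 0) - int (Suc i))" "s i = md n (int (s 0) - int i)"
          using less(1) by blast+
        then have "s j \<noteq> md n (int (s (Suc i)) + 1)" using no_back[of i] 3 less(2) n by auto
        then have "s j = md n (int (s (Suc i)) - 1)" using st[of "Suc i"] 3 less(2) by auto
        also have "\<dots> = md n (int (s 0) - int (Suc i) - 1)"
          using n i(1) by (simp only: int_md md_mod_add)
        also have "int (s 0) - int (Suc i) - 1 = int (s 0) - int j" using 3 by simp
        finally show ?thesis .
      qed
    qed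
    then have "\<forall>j<n. s j = md n (int n - int j - int k)" by (simp only: k) blast
    moreover have "k < n" using n by (simp add: k_def)
    ultimately show ?thesis by blast
  qed
qed

section \<open>Representatives of images under an isomorphism\<close>

locale H_isomorphism =
  fixes n :: nat and \<alpha> \<beta> \<alpha>' \<beta>' :: "nat \<Rightarrow> 'k::field" and \<phi>
  assumes n3: "3 \<le> n"
    and iso: "\<phi> \<in> ring_iso (H_alg n \<alpha> \<beta>) (H_alg n \<alpha>' \<beta>')"
    and scal: "\<phi> (H_scal n \<alpha> \<beta> c) = H_scal n \<alpha>' \<beta>' c"
begin

abbreviation "h f \<equiv> \<phi> (proj n \<alpha> \<beta> f)"
abbreviation "\<pi> \<equiv> proj n \<alpha>' \<beta>'"

text \<open>Representatives are only determined modulo \<^term>\<open>H_ideal n \<alpha>' \<beta>'\<close>, but their coefficients along paths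
  of length at most 2 are unique, since the relations are cubic.\<close>
definition lift :: "'k pelem \<Rightarrow> 'k pelem" where
  "lift f = (SOME g. g \<in> pcarrier n \<and> \<pi> g = h f)"

lemma proj_carrier: "f \<in> pcarrier n \<Longrightarrow> proj n a b f \<in> carrier (H_alg n a b)"
  using proj_hom by (rule ring_hom_closed)

lemma proj_plus: "f \<in> pcarrier n \<Longrightarrow> g \<in> pcarrier n \<Longrightarrow>
    proj n a b (\<lambda>p. f p + g p) = proj n a b f \<oplus>\<^bsub>H_alg n a b\<^esub> proj n a b g"
  using ring_hom_add[OF proj_hom, of f n g] by simp

lemma proj_mult: "f \<in> pcarrier n \<Longrightarrow> g \<in> pcarrier n \<Longrightarrow>
    proj n a b (pa_mult n f g) = proj n a b f \<otimes>\<^bsub>H_alg n a b\<^esub> proj n a b g"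
  using ring_hom_mult[OF proj_hom, of f n g] by simp

text \<open>A relation instead of a choice: it is compatible with sums and products exactly, whereas
  the chosen \<open>lift\<close> is so only modulo the ideal.\<close>

definition lifts :: "'k pelem \<Rightarrow> 'k pelem \<Rightarrow> bool" where
  "lifts f g \<longleftrightarrow> f \<in> pcarrier n \<and> g \<in> pcarrier n \<and> h f = \<pi> g"

lemma lifts_plus:
  assumes "lifts f g" "lifts f' g'" shows "lifts (\<lambda>p. f p + f' p) (\<lambda>p. g p + g' p)"
proof -
  from assms have c: "f \<in> pcarrier n" "f' \<in> pcarrier n" "g \<in> pcarrier n" "g' \<in> pcarrier n"
    and eq: "h f = \<pi> g" "h f' = \<pi> g'" by (auto simp: lifts_def)
  have "h (\<lambda>p. f p + f' p) = \<pi> (\<lambda>p. g p + g' p)"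
    unfolding proj_plus[OF c(1,2)] proj_plus[OF c(3,4)] eq[symmetric]
    by (intro ring_iso_memE(3)[OF iso] proj_carrier c)
  then show ?thesis using c by (simp add: lifts_def pcarrier_add)
qed

lemma lifts_mult:
  assumes "lifts f g" "lifts f' g'" shows "lifts (pa_mult n f f') (pa_mult n g g')"
proof -
  from assms have c: "f \<in> pcarrier n" "f' \<in> pcarrier n" "g \<in> pcarrier n" "g' \<in> pcarrier n"
    and eq: "h f = \<pi> g" "h f' = \<pi> g'" by (auto simp: lifts_def)
  have "h (pa_mult n f f') = \<pi> (pa_mult n g g')"
    unfolding proj_mult[OF c(1,2)] proj_mult[OF c(3,4)] eq[symmetric]
    by (intro ring_iso_memE(2)[OF iso] proj_carrier c)
  then show ?thesis using c by (simp add: lifts_def pcarrier_mult)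
qed

lemma lifts_const: "lifts (pa_const n c) (pa_const n c)"
  using scal by (simp add: lifts_def H_scal_proj)

lemma lifts_scale:
  assumes "lifts f g" shows "lifts (\<lambda>p. c * f p) (\<lambda>p. c * g p)"
proof -
  have "f \<in> pcarrier n" "g \<in> pcarrier n" using assms by (auto simp: lifts_def)
  then show ?thesis using lifts_mult[OF lifts_const assms, of c] by (simp only: pa_mult_const_left)
qed

lemma lifts_lift: assumes "f \<in> pcarrier n" shows "lifts f (lift f)"
proof -
  have "h f \<in> carrier (H_alg n \<alpha>' \<beta>')" using assms by (intro ring_iso_memE(1)[OF iso] proj_carrier)
  from proj_surj[OF this] have "\<exists>g. g \<in> pcarrier n \<and> \<pi> g = h f" by metis
  from someI_ex[OF this] have "lift f \<in> pcarrier n \<and> \<pi> (lift f) = h f"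
    unfolding lift_def .
  with assms show ?thesis by (simp add: lifts_def)
qed

text \<open>Two representatives of one class differ by an element of the ideal. Its vanishing in
  degree at most 2 makes short coefficients of \<open>lift\<close> well defined; its cubic
  conditions give the final equations.\<close>

lemma lifts_unique:
  assumes "lifts f g" "lifts f g'" shows "(\<lambda>p. g p - g' p) \<in> low_ideal n \<alpha>' \<beta>'"
proof -
  have "g \<in> pcarrier n" "g' \<in> pcarrier n" "\<pi> g = \<pi> g'" using assms by (simp_all add: lifts_def)
  then show ?thesis using H_ideal_subset_low_ideal by (auto simp: proj_eq_iff)
qed

lemma lift_carrier: "f \<in> pcarrier n \<Longrightarrow> lift f \<in> pcarrier n"
  using lifts_lift by (simp add: lifts_def)

lemma lift_short:
  assumes "lifts f g" "length as \<le> 2" shows "lift f (v, as) = g (v, as)"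
proof -
  have "lifts f (lift f)" using assms(1) by (intro lifts_lift) (simp add: lifts_def)
  then have "(\<lambda>p. lift f p - g p) \<in> low_ideal n \<alpha>' \<beta>'" using assms(1) by (rule lifts_unique)
  then have "lift f (v, as) - g (v, as) = 0" using assms(2) unfolding low_ideal_def by blast
  then show ?thesis by simp
qed

lemma lift_plus:
  assumes "f \<in> pcarrier n" "g \<in> pcarrier n" "length as \<le> 2"
  shows "lift (\<lambda>p. f p + g p) (v, as) = lift f (v, as) + lift g (v, as)"
  using lift_short[OF lifts_plus[OF lifts_lift lifts_lift]] assms by blast

lemma lift_mult:
  assumes "f \<in> pcarrier n" "g \<in> pcarrier n" "length as \<le> 2"
  shows "lift (pa_mult n f g) (v, as) = pa_mult n (lift f) (lift g) (v, as)"
  using lift_short[OF lifts_mult[OF lifts_lift lifts_lift]] assms by blast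

lemma lift_scale:
  assumes "f \<in> pcarrier n" "length as \<le> 2"
  shows "lift (\<lambda>p. c * f p) (v, as) = c * lift f (v, as)"
  using lift_short[OF lifts_scale[OF lifts_lift]] assms by blast

lemma lift_const: "length as \<le> 2 \<Longrightarrow> lift (pa_const n c) (v, as) = pa_const n c (v, as)"
  by (rule lift_short[OF lifts_const])

lemma lift_zero: "length as \<le> 2 \<Longrightarrow> lift (\<lambda>_. 0) (v, as) = 0"
  using lift_const[of as 0 v] by (simp add: pa_const_def split_beta')

text \<open>Here surjectivity of \<open>\<phi>\<close> enters. It yields injectivity of
  \<open>sigma\<close> and the nonzero arrow coefficients.\<close>

lemma lift_surj:
  assumes "g \<in> pcarrier n"
  shows "\<exists>f\<in>pcarrier n. \<forall>v as. length as \<le> 2 \<longrightarrow> lift f (v, as) = g (v, as)"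
proof -
  have "\<pi> g \<in> \<phi> ` carrier (H_alg n \<alpha> \<beta>)"
    using iso proj_carrier[OF assms] by (simp add: ring_iso_def bij_betw_def)
  then obtain f where "f \<in> pcarrier n" "\<pi> g = h f" using proj_surj by blast
  then have "lifts f g" using assms by (simp add: lifts_def)
  with lift_short \<open>f \<in> pcarrier n\<close> show ?thesis by blast
qed

lemma n_pos [simp]: "0 < n" using n3 by simp

text \<open>The absence of loops, on which the vanishing of characters on arrows rests.\<close>

lemma src_neq_tgt: "arr_idx a < n \<Longrightarrow> src n a \<noteq> tgt n a"
proof -
  have "Suc i mod n \<noteq> i" if "i < n" for i
    using that n3 by (cases "Suc i = n") (auto simp del: Suc_mod_sc)
  then show "arr_idx a < n \<Longrightarrow> src n a \<noteq> tgt n a"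
    by (cases a) (fastforce simp del: Suc_mod_sc)+
qed

section \<open>Vertex characters and the permutation they induce\<close>

abbreviation "E i \<equiv> bas (i, []) :: 'k pelem"
abbreviation "A a \<equiv> bas (src n a, [a]) :: 'k pelem"

lemma bas_arrow_eq:
  assumes "arr_idx a < n"
  shows "pa_mult n (E (src n a)) (A a) = A a" "pa_mult n (A a) (E (tgt n a)) = A a"
  using assms by (simp_all add: pa_mult_bas)

lemma lift_mult_0: "f \<in> pcarrier n \<Longrightarrow> g \<in> pcarrier n \<Longrightarrow> v < n \<Longrightarrow>
    lift (pa_mult n f g) (v, []) = lift f (v, []) * lift g (v, [])"
  by (simp add: lift_mult pa_mult_apply)

text \<open>The characters of the path algebra are the vertex evaluations: orthogonality of the idempotents
  singles out one vertex, and arrows are killed because the quiver has no loops.\<close>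
lemma ex_vertex:
  assumes v: "v < n" shows "\<exists>i<n. \<forall>f\<in>pcarrier n. lift f (v, []) = f (i, [])"
proof -
  define \<chi> where "\<chi> f = lift f (v, [])" for f
  have mult: "\<chi> (pa_mult n f g) = \<chi> f * \<chi> g" if "f \<in> pcarrier n" "g \<in> pcarrier n" for f g
    using that v by (simp add: \<chi>_def lift_mult_0)
  have lin: "\<chi> (\<lambda>p. f p + c * bas (w, as) p) = \<chi> f + c * \<chi> (bas (w, as))"
    if "f \<in> pcarrier n" "walk n w as" for f c w as
    using that by (simp add: \<chi>_def lift_plus lift_scale pcarrier_scale)
  have orth: "\<chi> (E i) * \<chi> (E j) = (if i = j then \<chi> (E i) else 0)" if "i < n" "j < n" for i j
    using mult[of "E i" "E j"] that by (simp add: pa_mult_bas \<chi>_def lift_zero split: if_splits)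
  have path: "\<chi> (bas (w, a # as)) = 0" if w: "walk n w (a # as)" for w a as
  proof -
    from w have a: "arr_idx a < n" "w = src n a" and w': "walk n (tgt n a) as" by auto
    have "\<chi> (A a) = \<chi> (E (src n a)) * \<chi> (A a)" "\<chi> (A a) = \<chi> (A a) * \<chi> (E (tgt n a))"
      using mult[of "E (src n a)" "A a"] mult[of "A a" "E (tgt n a)"] a by (simp_all add: bas_arrow_eq)
    moreover have "\<chi> (E (src n a)) * \<chi> (E (tgt n a)) = 0"
      using orth[of "src n a" "tgt n a"] src_neq_tgt a by simp
    ultimately have "\<chi> (A a) = 0" by auto
    moreover have "bas (w, a # as) = pa_mult n (A a) (bas (tgt n a, as))"
      using a w' by (simp add: pa_mult_bas)
    ultimately show ?thesis using mult[of "A a" "bas (tgt n a, as)"] a w' by simp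
  qed
  \<comment> \<open>Otherwise the character would vanish on every basis path, contradicting its
    value 1 at the unit.\<close>
  have "\<exists>i<n. \<chi> (E i) \<noteq> 0"
  proof (rule ccontr)
    assume neg: "\<not> (\<exists>i<n. \<chi> (E i) \<noteq> 0)"
    have "\<chi> f = 0" if "f \<in> pcarrier n" for f
      using that
    proof (induction rule: pcarrier_induct)
      case (add g c w as)
      then have "\<chi> (bas (w, as)) = 0" using neg path walk_start by (cases as) auto
      with add show ?case by (simp add: lin)
    qed (auto simp: \<chi>_def lift_zero)
    from this[of "pa_const n 1"] show False
      using v lift_const[of "[]" 1 v] by (simp add: \<chi>_def) (simp add: pa_const_def)
  qed
  then obtain i where i: "i < n" "\<chi> (E i) \<noteq> 0" by auto
  then have 1: "\<chi> (E i) = 1" using orth[of i i] by simp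
  have 0: "\<chi> (E j) = 0" if "j < n" "j \<noteq> i" for j using orth[of i j] i that by auto
  have "\<chi> f = f (i, [])" if "f \<in> pcarrier n" for f
    using that
  proof (induction rule: pcarrier_induct)
    case (add g c w as)
    then have "\<chi> (bas (w, as)) = bas (w, as) (i, [])"
      using path walk_start 0 1 by (cases as) (auto simp: bas_def)
    with add show ?case by (simp add: lin)
  qed (auto simp: \<chi>_def lift_zero)
  with i show ?thesis by (auto simp: \<chi>_def)
qed

text \<open>Characters pull back, so \<open>sigma\<close> runs from the vertices of the target
  algebra to those of the source.\<close>

definition sigma :: "nat \<Rightarrow> nat" where
  "sigma v = (SOME i. i < n \<and> (\<forall>f\<in>pcarrier n. lift f (v, []) = f (i, [])))"

lemma sigma:
  assumes "v < n"
  shows "sigma v < n" "\<And>f. f \<in> pcarrier n \<Longrightarrow> lift f (v, []) = f (sigma v, [])"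
  using someI_ex[of "\<lambda>i. i < n \<and> (\<forall>f\<in>pcarrier n. lift f (v, []) = f (i, []))"] ex_vertex[OF assms]
  unfolding sigma_def by blast+

text \<open>If \<open>sigma\<close> identified two vertices, no lift could take different values
  there; but a preimage of \<open>E v\<close> separates \<open>v\<close> from every other
  vertex.\<close>

lemma inj_sigma: "inj_on sigma {..<n}"
proof (rule inj_onI, rule ccontr)
  fix v w assume *: "v \<in> {..<n}" "w \<in> {..<n}" "sigma v = sigma w" "v \<noteq> w"
  obtain f where f: "f \<in> pcarrier n" "\<And>x. lift f (x, []) = E v (x, [])"
    using lift_surj[of "E v"] * by auto
  then have "E v (v, []) = E v (w, [])" using sigma[of v] sigma[of w] * by (metis lessThan_iff)
  then show False using * by (simp add: bas_def)
qed

lemma surj_sigma: "sigma ` {..<n} = {..<n}"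
  by (rule endo_inj_surj) (auto simp: sigma inj_sigma)

section \<open>Arrows modulo the square of the arrow ideal\<close>

text \<open>\<open>coef b a\<close> is the coefficient of the arrow \<open>b\<close> in the image of the arrow \<open>a\<close>.\<close>
definition coef :: "arr \<Rightarrow> arr \<Rightarrow> 'k" where
  "coef b a = lift (A a) (src n b, [b])"

text \<open>A path of length one has two cuts, which gives a Leibniz rule: the coefficient along
  \<open>b\<close> is a derivation with respect to the characters at the two ends of
  \<open>b\<close>.\<close>

lemma lift_mult_1:
  assumes "f \<in> pcarrier n" "g \<in> pcarrier n" "arr_idx b < n"
  shows "lift (pa_mult n f g) (src n b, [b])
    = f (sigma (src n b), []) * lift g (src n b, [b]) + lift f (src n b, [b]) * g (sigma (tgt n b), [])"
  using assms by (simp add: lift_mult pa_mult_apply sigma atMost_Suc)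

text \<open>Multiplying \<open>A a\<close> by its end idempotents changes nothing, while by the
  Leibniz rule it multiplies the coefficient along \<open>b\<close> by 0 unless the end points match
  under \<open>sigma\<close>.\<close>

lemma coef_nonzero:
  assumes "coef b a \<noteq> 0" "arr_idx a < n" "arr_idx b < n"
  shows "src n a = sigma (src n b)" "tgt n a = sigma (tgt n b)"
proof -
  have "coef b a = E (src n a) (sigma (src n b), []) * coef b a"
    using lift_mult_1[of "E (src n a)" "A a" b] assms(2,3)
    by (simp add: bas_arrow_eq coef_def) (simp add: bas_def)
  with assms(1) show "src n a = sigma (src n b)" by (auto simp: bas_def split: if_splits)
  have "coef b a = coef b a * E (tgt n a) (sigma (tgt n b), [])"
    using lift_mult_1[of "A a" "E (tgt n a)" b] assms(2,3)
    by (simp add: bas_arrow_eq coef_def) (simp add: bas_def)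
  with assms(1) show "tgt n a = sigma (tgt n b)" by (auto simp: bas_def split: if_splits)
qed

text \<open>A preimage of the arrow \<open>b\<close> has no vertex part because \<open>sigma\<close>
  is onto. Its paths of length at least 2 contribute nothing in degree one, so some arrow has to
  contribute.\<close>

lemma ex_coef_nonzero:
  assumes b: "arr_idx b < n" shows "\<exists>a. arr_idx a < n \<and> coef b a \<noteq> 0"
proof (rule ccontr)
  assume neg: "\<not> (\<exists>a. arr_idx a < n \<and> coef b a \<noteq> 0)"
  obtain f where f: "f \<in> pcarrier n"
    and lf: "\<And>v as. length as \<le> 2 \<Longrightarrow> lift f (v, as) = A b (v, as)"
    using lift_surj[of "A b"] b by auto
  have "f (i, []) = 0" for i
  proof (cases "i < n")
    case True
    then obtain v where "v < n" "i = sigma v" using surj_sigma by (metis imageE lessThan_iff)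
    then show ?thesis using sigma(2)[of v f] f lf[of "[]" v] by (simp add: bas_def)
  next
    case False
    then show ?thesis using f by (auto intro: pcarrier_not_walk)
  qed
  then have "\<forall>p. f p \<noteq> 0 \<longrightarrow> snd p \<noteq> []" by auto
  with f have "lift f (src n b, [b]) = 0"
  proof (induction rule: pcarrier_induct_support)
    case (add g c w as)
    then obtain a bs where as: "as = a # bs" by (cases as) auto
    with add have a: "arr_idx a < n" "w = src n a" "walk n (tgt n a) bs" by auto
    have "lift (bas (w, as)) (src n b, [b]) = 0"
    proof (cases bs)
      case Nil
      then show ?thesis using neg a as by (auto simp: coef_def)
    next
      case (Cons c cs)
      have "bas (w, as) = pa_mult n (A a) (bas (tgt n a, bs))"
        using a as by (simp add: pa_mult_bas)
      \<comment> \<open>Neither factor has a vertex part, so both terms of the Leibniz rule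
        vanish.\<close>
      moreover have "A a (sigma (src n b), []) = 0" "bas (tgt n a, bs) (sigma (tgt n b), []) = (0::'k)"
        by (simp_all add: bas_def Cons)
      ultimately show ?thesis using lift_mult_1[of "A a" "bas (tgt n a, bs)" b] a b by simp
    qed
    with add show ?case by (simp add: lift_plus lift_scale pcarrier_scale)
  qed (simp add: lift_zero)
  with lf[of "[b]" "src n b"] show False by (simp add: bas_def)
qed

lemma lift_arrow_Nil: assumes "arr_idx a < n" shows "lift (A a) (v, []) = 0"
proof (cases "v < n")
  case True
  moreover have "A a (sigma v, []) = 0" by (simp add: bas_def)
  ultimately show ?thesis using sigma(2)[of v "A a"] assms by simp
next
  case False
  then show ?thesis using lift_carrier[of "A a"] assms by (intro pcarrier_not_walk) auto
qed

section \<open>Images of the cubic relations\<close>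

text \<open>A product of lifted arrows instead of the lift of a cubic path: the cubic coefficients
  of \<open>lift\<close> depend on the choice made, while those of this product are computable from
  \<open>coef\<close>.\<close>

definition lift3 :: "arr \<Rightarrow> arr \<Rightarrow> arr \<Rightarrow> 'k pelem" where
  "lift3 a b c = pa_mult n (lift (A a)) (pa_mult n (lift (A b)) (lift (A c)))"

lemma lifts_lift3:
  assumes "walk n v [a, b, c]" shows "lifts (bas (v, [a, b, c])) (lift3 a b c)"
proof -
  have "bas (v, [a, b, c]) = pa_mult n (A a) (pa_mult n (A b) (A c))"
    using assms by (simp add: pa_mult_bas)
  then show ?thesis using assms unfolding lift3_def by (auto intro!: lifts_mult lifts_lift)
qed

text \<open>Lifted arrows have no vertex part, so only the cut into three single arrows
  survives.\<close>

lemma lift3_coef: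
  assumes "walk n v [x, y, z]" "arr_idx a < n" "arr_idx b < n" "arr_idx c < n"
  shows "lift3 a b c (v, [x, y, z]) = coef x a * coef y b * coef z c"
proof -
  have "src n x = v" "src n y = tgt n x" "src n z = tgt n y" using assms(1) by simp_all
  with assms show ?thesis
    by (simp add: lift3_def pa_mult_apply atMost_Suc lift_arrow_Nil coef_def mult.assoc)
qed

text \<open>The relation is zero in the source algebra, so 0 is a second representative of its image
  and \<open>lifts_unique\<close> applies.\<close>

lemma lift_rel1:
  assumes i: "i < n"
  shows "(\<lambda>p. lift3 (D (pr n i)) (U (pr n i)) (U i) p - \<alpha> i * lift3 (U i) (D i) (U i) p
     - \<beta> i * lift3 (U i) (U (sc n i)) (D (sc n i)) p) \<in> low_ideal n \<alpha>' \<beta>'" (is "?G \<in> _")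
proof -
  have "lifts (rel1 n \<alpha> \<beta> i) (\<lambda>p. (lift3 (D (pr n i)) (U (pr n i)) (U i) p
    + (- \<alpha> i) * lift3 (U i) (D i) (U i) p) + (- \<beta> i) * lift3 (U i) (U (sc n i)) (D (sc n i)) p)"
    (is "lifts _ ?g")
  proof -
    have "rel1 n \<alpha> \<beta> i = (\<lambda>p. (bas (i, [D (pr n i), U (pr n i), U i]) p
        + (- \<alpha> i) * bas (i, [U i, D i, U i]) p)
        + (- \<beta> i) * bas (i, [U i, U (sc n i), D (sc n i)]) p)"
      by (simp add: rel1_def)
    moreover have "walk n i [D (pr n i), U (pr n i), U i]" "walk n i [U i, D i, U i]"
      "walk n i [U i, U (sc n i), D (sc n i)]" using i by simp_all
    ultimately show ?thesis by (simp only:) (intro lifts_plus lifts_scale lifts_lift3)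
  qed
  moreover have "lifts (rel1 n \<alpha> \<beta> i) (\<lambda>_. 0)"
  proof -
    have "proj n \<alpha> \<beta> (rel1 n \<alpha> \<beta> i) = proj n \<alpha> \<beta> (\<lambda>_. 0)"
      using rels_subset_H_ideal[of n \<alpha> \<beta>] i by (auto simp: proj_eq_iff pcarrier_rel)
    moreover have "lifts (\<lambda>_. 0) (\<lambda>_. 0)"
      using lifts_const[of 0] by (simp add: pa_const_def split_def)
    ultimately show ?thesis using i by (simp add: lifts_def pcarrier_rel)
  qed
  ultimately have "(\<lambda>p. ?g p - 0) \<in> low_ideal n \<alpha>' \<beta>'" by (rule lifts_unique)
  then show ?thesis by simp
qed

text \<open>An arrow with nonzero coefficient along \<open>U j\<close> joins \<open>sigma j\<close>
  to \<open>sigma (sc n j)\<close>; hence these vertices are neighbours on the cycle.\<close>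

lemma sigma_dihedral:
  "\<exists>k<n. (\<forall>j<n. sigma j = md n (int j + int k)) \<or> (\<forall>j<n. sigma j = md n (int n - int j - int k))"
proof (rule dihedral[OF n3 inj_sigma sigma(1)])
  fix j assume j: "j < n"
  from ex_coef_nonzero[of "U j"] j obtain a where "arr_idx a < n" "coef (U j) a \<noteq> 0" by auto
  with coef_nonzero[of "U j" a] j have a: "src n a = sigma j" "tgt n a = sigma (sc n j)" "arr_idx a < n" by auto
  show "sigma (sc n j) = md n (int (sigma j) + 1) \<or> sigma (sc n j) = md n (int (sigma j) - 1)"
  proof (cases a)
    case (U i)
    then show ?thesis using a by (simp add: sc_def)
  next
    case (D i)
    then have "sigma j = sc n i" "sigma (sc n j) = i" "i < n" using a by auto
    then have "sigma (sc n j) = pr n (sigma j)" by simp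
    then show ?thesis by (simp add: pr_def)
  qed
qed

text \<open>For \<open>n \<ge> 3\<close> an up arrow and a down arrow are never parallel, so each
  arrow has exactly one possible image direction.\<close>

lemma no_two_torsion: "md n (x + 1) \<noteq> md n (x - 1)"
  using n3 by (auto simp: md_eq_iff dest: zdvd_imp_le)

lemma rotation_case:
  assumes s: "\<And>j. j < n \<Longrightarrow> sigma j = md n (int j + int k)"
  shows "\<exists>lam. (\<forall>i<n. lam i \<noteq> 0) \<and> (\<forall>i<n.
     \<alpha>' i = lam (md n (int i + int k)) / lam (md n (int i + int k - 1)) * \<alpha> (md n (int i + int k))
   \<and> \<beta>' i = lam (md n (int i + int k + 1)) / lam (md n (int i + int k - 1)) * \<beta> (md n (int i + int k)))"
proof -
  define mU where "mU j = coef (U j) (U (sigma j))" for j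
  define mD where "mD j = coef (D j) (D (sigma j))" for j
  have sc: "sigma (sc n j) = sc n (sigma j)" if "j < n" for j
    using that by (simp add: s sc_def) (simp add: algebra_simps)
  have pr: "sigma (pr n j) = pr n (sigma j)" if "j < n" for j
    using that by (simp add: s pr_def) (simp add: algebra_simps)
  have no2: "sc n (sc n x) \<noteq> x" if "x < n" for x
    using no_two_torsion[of "int x + 1"] that by (simp add: sc_def algebra_simps)
  have UD: "coef (U j) (D x) = 0" and DU: "coef (D j) (U x) = 0" if "j < n" "x < n" for j x
    using coef_nonzero[of "U j" "D x"] coef_nonzero[of "D j" "U x"] that sc[of j]
      no2[of "sigma j"] no2[of x] sigma(1)[of j] by auto
  have U: "mU j \<noteq> 0" if j: "j < n" for j
  proof -
    obtain a where a: "arr_idx a < n" "coef (U j) a \<noteq> 0" using ex_coef_nonzero[of "U j"] j by auto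
    then show ?thesis using coef_nonzero[of "U j" a] UD that by (cases a) (auto simp: mU_def)
  qed
  have D: "mD j \<noteq> 0" if j: "j < n" for j
  proof -
    obtain a where a: "arr_idx a < n" "coef (D j) a \<noteq> 0" using ex_coef_nonzero[of "D j"] j by auto
    then show ?thesis using coef_nonzero[of "D j" a] DU that by (cases a) (auto simp: mD_def)
  qed
  define t where "t j = mU j * mD j" for j
  \<comment> \<open>\<open>t\<close> is indexed by target vertices; the inverse rotation transports
    it to source indices.\<close>
  define lam where "lam x = t (md n (int x - int k))" for x
  have lam: "lam (sigma j) = t j" if "j < n" for j
    using that by (simp add: lam_def s)
  have main: "\<alpha>' i = t i / t (pr n i) * \<alpha> (sigma i) \<and> \<beta>' i = t (sc n i) / t (pr n i) * \<beta> (sigma i)"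
    if i: "i < n" for i
  proof -
    have l: "sigma i < n" "sigma (pr n i) < n" "sigma (sc n i) < n" using i by (simp_all add: sigma)
    \<comment> \<open>The image of the first relation at \<open>sigma i\<close> is read off along
      the cubic paths starting at \<open>i\<close>. By \<open>UD\<close> and \<open>DU\<close> just
      one lifted monomial survives on each path, and the factor \<open>mU i\<close> cancels
      later.\<close>
    note G = low_idealD(1,2)[OF lift_rel1[OF l(1), folded sc[OF i] pr[OF i]] i]
    have "mU i * (mD i * (mU i * \<alpha> (sigma i))) = \<alpha>' i * (mD (pr n i) * (mU (pr n i) * mU i))"
     "mU i * (mU (sc n i) * (mD (sc n i) * \<beta> (sigma i))) = \<beta>' i * (mD (pr n i) * (mU (pr n i) * mU i))"
      using G i l by (simp_all add: lift3_coef UD DU mU_def mD_def algebra_simps)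
    then show ?thesis
      using U[OF i] U[of "pr n i"] D[of "pr n i"] unfolding t_def by (simp add: field_simps)
  qed
  have "lam x \<noteq> 0" for x using U D by (simp add: lam_def t_def)
  moreover have "md n (int i + int k) = sigma i" "md n (int i + int k - 1) = sigma (pr n i)"
    "md n (int i + int k + 1) = sigma (sc n i)" if "i < n" for i
    using that by (simp_all add: s pr_def sc_def) (simp_all add: algebra_simps)
  ultimately show ?thesis using main by (intro exI[of _ lam]) (simp add: lam)
qed

text \<open>A reflection exchanges up and down arrows, so the image of a relation of the first
  family is compared with one of the second. There the leading monomial and the
  \<open>\<beta>\<close> monomial trade places, which inverts \<open>\<beta>\<close> and produces
  the sign.\<close>

lemma reflection_case:
  assumes s: "\<And>j. j < n \<Longrightarrow> sigma j = md n (int n - int j - int k)"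
  shows "\<exists>lam. (\<forall>i<n. lam i \<noteq> 0) \<and> (\<forall>i<n.
     \<alpha>' i = - (lam (md n (int n - int i - int k - 1)) * \<alpha> (md n (int n - int i - int k - 1))
         / (lam (md n (int n - int i - int k)) * \<beta> (md n (int n - int i - int k - 1))))
   \<and> \<beta>' i = lam (md n (int n - int i - int k - 2))
         / (lam (md n (int n - int i - int k)) * \<beta> (md n (int n - int i - int k - 1))))"
proof -
  \<comment> \<open>The edge from \<open>j\<close> to \<open>j + 1\<close> is reflected to the edge
    joining \<open>sigma (sc n j)\<close> and \<open>sigma j\<close>; its arrows carry the index of
    the former vertex.\<close>
  define r where "r j = md n (int n - int j - int k - 1)" for j
  define mU where "mU j = coef (U j) (D (r j))" for j
  define mD where "mD j = coef (D j) (U (r j))" for j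
  have rl: "r j < n" for j by (simp add: r_def)
  have sc: "sigma (sc n j) = r j" "sc n (r j) = sigma j" if "j < n" for j
    using that by (simp_all add: s sc_def r_def) (simp_all add: algebra_simps)
  have r_md: "r (md n x) = md n (int n - x - int k - 1)" for x
  proof -
    have "r (md n x) = md n (int n - int k - 1 - x mod int n)" by (simp add: r_def algebra_simps)
    also have "\<dots> = md n (int n - int k - 1 - x)" by (rule md_mod_add)
    finally show ?thesis by (simp add: algebra_simps)
  qed
  have r_pr: "r (pr n j) = sc n (r j)" and r_sc: "r (sc n j) = pr n (r j)" for j
    by (simp_all add: pr_def sc_def r_md) (simp_all add: r_def algebra_simps md_diff_self)
  have no2: "sc n (sc n x) \<noteq> x" if "x < n" for x
    using no_two_torsion[of "int x + 1"] that by (simp add: sc_def algebra_simps)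
  have UU: "coef (U j) (U x) = 0" and DD: "coef (D j) (D x) = 0" if "j < n" "x < n" for j x
    using coef_nonzero[of "U j" "U x"] coef_nonzero[of "D j" "D x"] that sc[of j]
      no2[of "r j"] rl[of j] by auto
  have U: "mU j \<noteq> 0" if j: "j < n" for j
  proof -
    obtain a where a: "arr_idx a < n" "coef (U j) a \<noteq> 0" using ex_coef_nonzero[of "U j"] j by auto
    then show ?thesis using coef_nonzero[of "U j" a] UU that sc by (cases a) (auto simp: mU_def)
  qed
  have D: "mD j \<noteq> 0" if j: "j < n" for j
  proof -
    obtain a where a: "arr_idx a < n" "coef (D j) a \<noteq> 0" using ex_coef_nonzero[of "D j"] j by auto
    then show ?thesis using coef_nonzero[of "D j" a] DD that sc by (cases a) (auto simp: mD_def)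
  qed
  define t where "t j = mU j * mD j" for j
  \<comment> \<open>\<open>r\<close> is an involution on indices below \<open>n\<close>, so this
    amounts to \<open>lam (r j) = t j\<close>.\<close>
  define lam where "lam x = t (r x)" for x
  have lam: "lam (r j) = t j" if "j < n" for j
    using that r_md[of "int n - int j - int k - 1"] by (simp add: lam_def r_def[of j])
  have main: "\<alpha>' i = - (t i * \<alpha> (r i) / (t (pr n i) * \<beta> (r i)))
     \<and> \<beta>' i = t (sc n i) / (t (pr n i) * \<beta> (r i))" if i: "i < n" for i
  proof -
    have l: "r i < n" "r (pr n i) < n" "r (sc n i) < n" by (simp_all add: rl)
    note G = low_idealD(3,4)[OF lift_rel1[OF l(1), folded r_sc r_pr] i]
    have *: "- (mD i * (mU i * (mD i * \<alpha> (r i)))) = \<alpha>' i * (mD i * (mD (pr n i) * (mU (pr n i) * \<beta> (r i))))"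
     "mU (sc n i) * (mD (sc n i) * mD i) = \<beta>' i * (mD i * (mD (pr n i) * (mU (pr n i) * \<beta> (r i))))"
      using G i l by (simp_all add: lift3_coef UU DD mU_def mD_def algebra_simps)
    \<comment> \<open>The left side of the second equation is a product of nonzero scalars.\<close>
    have "\<beta> (r i) \<noteq> 0"
      using *(2) U[of "sc n i"] D[of "sc n i"] D[OF i] by auto
    then have q: "t (pr n i) * \<beta> (r i) \<noteq> 0" using U D by (simp add: t_def)
    have "mD i * (\<alpha>' i * (t (pr n i) * \<beta> (r i)) + t i * \<alpha> (r i)) =
       mD i * (mU i * (mD i * \<alpha> (r i))) + \<alpha>' i * (mD i * (mD (pr n i) * (mU (pr n i) * \<beta> (r i))))"
      by (simp add: t_def algebra_simps)
    also have "\<dots> = 0" unfolding *(1)[symmetric] by simp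
    finally have "\<alpha>' i * (t (pr n i) * \<beta> (r i)) = - (t i * \<alpha> (r i))"
      using D[OF i] by (simp add: eq_neg_iff_add_eq_0)
    then have "\<alpha>' i = - (t i * \<alpha> (r i)) / (t (pr n i) * \<beta> (r i))"
      using q by (metis nonzero_eq_divide_eq)
    moreover have \<beta>': "\<beta>' i * (t (pr n i) * \<beta> (r i)) = t (sc n i)"
      using *(2) D[OF i] by (simp add: t_def mult_ac)
    then have "\<beta>' i = t (sc n i) / (t (pr n i) * \<beta> (r i))"
      using q by (metis nonzero_eq_divide_eq)
    ultimately show ?thesis by simp
  qed
  have "lam x \<noteq> 0" for x using U D rl by (simp add: lam_def t_def)
  moreover have "md n (int n - int i - int k - 1) = r i" "md n (int n - int i - int k) = r (pr n i)"
    "md n (int n - int i - int k - 2) = r (sc n i)" for i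
    unfolding pr_def sc_def r_md by (simp_all add: r_def algebra_simps)
  ultimately show ?thesis using main by (intro exI[of _ lam]) (simp add: lam)
qed

end

subsection \<open>Isomorphisms induced by rescaled quiver symmetries\<close>

lemma scale_rel_in_H_ideal:
  assumes "r \<in> rels n \<alpha> \<beta>" shows "(\<lambda>p. c * r p) \<in> H_ideal n \<alpha> \<beta>"
proof -
  have r: "r \<in> H_ideal n \<alpha> \<beta>" "r \<in> pcarrier n" using assms rels_subset_H_ideal rels_carrier by blast+
  then have "pa_mult n (pa_const n c) r \<in> H_ideal n \<alpha> \<beta>"
    using ideal.I_l_closed[OF ideal_H_ideal, of r n \<alpha> \<beta> "pa_const n c"] by simp
  then show ?thesis using r by (simp add: pa_mult_const_left)
qed

section \<open>Weighted pull-back along a quiver symmetry\<close>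

text \<open>Defined by precomposition, hence contravariant on paths: the basis path
  \<open>(\<tau> u, map \<rho> bs)\<close> goes to a multiple of \<open>(u, bs)\<close>. This fits
  the formulas, which express primed parameters at \<open>i\<close> through unprimed ones at the
  shifted index.\<close>

definition twist :: "nat \<Rightarrow> (nat \<Rightarrow> nat) \<Rightarrow> (arr \<Rightarrow> arr) \<Rightarrow> (arr \<Rightarrow> 'k) \<Rightarrow> 'k::field pelem \<Rightarrow> 'k pelem" where
  "twist n \<tau> \<rho> w f = (\<lambda>(v, as).
     if walk n v as then prod_list (map w as) * f (\<tau> v, map \<rho> as) else 0)"

lemma twist_scale: "twist n \<tau> \<rho> w (\<lambda>p. c * f p) = (\<lambda>p. c * twist n \<tau> \<rho> w f p)"
  by (auto simp: twist_def)

lemma twist_add: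
  "twist n \<tau> \<rho> w (\<lambda>p. f p + g p) = (\<lambda>p. twist n \<tau> \<rho> w f p + twist n \<tau> \<rho> w g p)"
  by (auto simp: twist_def algebra_simps)

locale quiver_iso =
  fixes n :: nat and \<tau> \<tau>' :: "nat \<Rightarrow> nat" and \<rho> \<rho>' :: "arr \<Rightarrow> arr" and w :: "arr \<Rightarrow> 'k::field"
  assumes tau: "v < n \<Longrightarrow> \<tau> v < n \<and> \<tau>' (\<tau> v) = v"
    and tau': "v < n \<Longrightarrow> \<tau>' v < n \<and> \<tau> (\<tau>' v) = v"
    and rho: "arr_idx a < n \<Longrightarrow> arr_idx (\<rho> a) < n \<and> \<rho>' (\<rho> a) = a \<and> src n (\<rho> a) = \<tau> (src n a) \<and> tgt n (\<rho> a) = \<tau> (tgt n a)"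
    and rho': "arr_idx a < n \<Longrightarrow> arr_idx (\<rho>' a) < n \<and> \<rho> (\<rho>' a) = a"
    and weight: "arr_idx a < n \<Longrightarrow> w a \<noteq> 0"
begin

text \<open>Lets every result about \<open>\<Theta>\<close> be reused for its inverse. Reading the
  weight at \<open>\<rho>' a\<close> makes the weights cancel in the composition.\<close>

lemma inverse: "quiver_iso n \<tau>' \<tau> \<rho>' \<rho> (\<lambda>a. inverse (w (\<rho>' a)))"
proof
  fix a assume a: "arr_idx a < n"
  let ?b = "\<rho>' a"
  have "arr_idx ?b < n" "\<rho> ?b = a" using rho'[OF a] by auto
  moreover from this have "src n a = \<tau> (src n ?b)" "tgt n a = \<tau> (tgt n ?b)" using rho[of ?b] by auto
  ultimately show "arr_idx ?b < n \<and> \<rho> ?b = a \<and> src n ?b = \<tau>' (src n a) \<and> tgt n ?b = \<tau>' (tgt n a)"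
    using tau src_tgt_less[of ?b n] by simp
qed (use tau tau' rho rho' weight in auto)

lemma walk_map:
  "walk n v as \<Longrightarrow> walk n (\<tau> v) (map \<rho> as) \<and> endv n (\<tau> v) (map \<rho> as) = \<tau> (endv n v as)"
proof (induction as arbitrary: v)
  case (Cons a as)
  then show ?case using rho[of a] tau by auto
qed (auto simp: tau)

lemma map_inverse: "walk n v as \<Longrightarrow> map \<rho>' (map \<rho> as) = as"
  by (induction as arbitrary: v) (auto simp: rho)

lemma prod_weight_nonzero: "walk n v as \<Longrightarrow> prod_list (map w as) \<noteq> 0"
  by (induction as arbitrary: v) (auto simp: weight)

abbreviation "\<Theta> \<equiv> twist n \<tau> \<rho> w"

lemma twist_carrier:
  assumes f: "f \<in> pcarrier n" shows "\<Theta> f \<in> pcarrier n"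
proof -
  have "p \<in> (\<lambda>(v, as). (\<tau>' v, map \<rho>' as)) ` {p. f p \<noteq> 0}" if p: "\<Theta> f p \<noteq> 0" for p
  proof -
    obtain v as where [simp]: "p = (v, as)" by force
    from p have "walk n v as" "f (\<tau> v, map \<rho> as) \<noteq> 0" by (auto simp: twist_def split: if_splits)
    moreover from this have "(v, as) = (\<tau>' (\<tau> v), map \<rho>' (map \<rho> as))"
      using map_inverse tau walk_start by metis
    ultimately show ?thesis by (intro image_eqI[of _ _ "(\<tau> v, map \<rho> as)"]) auto
  qed
  then have "{p. \<Theta> f p \<noteq> 0} \<subseteq> (\<lambda>(v, as). (\<tau>' v, map \<rho>' as)) ` {p. f p \<noteq> 0}" by blast
  then have "finite {p. \<Theta> f p \<noteq> 0}" by (rule finite_subset) (use f in \<open>simp add: pcarrier_iff\<close>)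
  then show ?thesis by (auto simp: pcarrier_iff twist_def split: if_splits)
qed

text \<open>The symmetry maps cuts of a path to cuts of its image, and weights multiply along
  concatenation.\<close>

lemma twist_mult: "\<Theta> (pa_mult n f g) = pa_mult n (\<Theta> f) (\<Theta> g)"
proof (rule ext, clarify)
  fix v as
  show "\<Theta> (pa_mult n f g) (v, as) = pa_mult n (\<Theta> f) (\<Theta> g) (v, as)"
  proof (cases "walk n v as")
    case True
    have "prod_list (map w (take j as)) * prod_list (map w (drop j as)) = prod_list (map w as)" for j
      by (metis append_take_drop_id map_append prod_list.append)
    then have "prod_list (map w as) * (f (\<tau> v, take j (map \<rho> as))
         * g (endv n (\<tau> v) (take j (map \<rho> as)), drop j (map \<rho> as)))
      = \<Theta> f (v, take j as) * \<Theta> g (endv n v (take j as), drop j as)" for j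
      using walk_take_drop[OF True, of j] walk_map[of v "take j as"]
      by (simp add: twist_def take_map drop_map mult_ac)
    then show ?thesis using True walk_map[OF True]
      by (simp add: pa_mult_apply sum_distrib_left) (simp add: twist_def pa_mult_apply sum_distrib_left)
  qed (simp add: twist_def pa_mult_def)
qed

lemma twist_const: "\<Theta> (pa_const n c) = pa_const n c"
  using tau by (auto simp: twist_def pa_const_def)

lemma twist_hom: "\<Theta> \<in> ring_hom (path_alg n) (path_alg n)"
  by (rule ring_hom_memI)
    (simp_all add: twist_carrier twist_mult twist_const twist_add)

lemma twist_bas:
  assumes u: "walk n u bs"
  shows "\<Theta> (bas (\<tau> u, map \<rho> bs)) = (\<lambda>p. prod_list (map w bs) * bas (u, bs) p)"
proof (rule ext, clarify)
  fix v as
  show "\<Theta> (bas (\<tau> u, map \<rho> bs)) (v, as) = prod_list (map w bs) * bas (u, bs) (v, as)"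
  proof (cases "walk n v as")
    case True
    then have "\<tau> v = \<tau> u \<and> map \<rho> as = map \<rho> bs \<longleftrightarrow> v = u \<and> as = bs"
      using map_inverse[OF True] map_inverse[OF u] tau[OF walk_start[OF True]] tau[OF walk_start[OF u]]
      by metis
    then show ?thesis using True by (auto simp: twist_def bas_def)
  qed (use u in \<open>auto simp: twist_def bas_def\<close>)
qed

lemma twist_inverse:
  assumes f: "f \<in> pcarrier n"
  shows "twist n \<tau>' \<rho>' (\<lambda>a. inverse (w (\<rho>' a))) (\<Theta> f) = f"
proof (rule ext, clarify)
  fix v as
  interpret inv: quiver_iso n \<tau>' \<tau> \<rho>' \<rho> "\<lambda>a. inverse (w (\<rho>' a))" by (rule inverse)
  show "twist n \<tau>' \<rho>' (\<lambda>a. inverse (w (\<rho>' a))) (\<Theta> f) (v, as) = f (v, as)"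
  proof (cases "walk n v as")
    case True
    note w = inv.walk_map[OF True] inv.map_inverse[OF True] tau'[OF walk_start[OF True]]
    have "prod_list (map (\<lambda>a. inverse (w (\<rho>' a))) as) * prod_list (map w (map \<rho>' as)) = 1"
      using True
    proof (induction as arbitrary: v)
      case (Cons a as)
      then show ?case using weight[of "\<rho>' a"] rho'[of a] Cons.IH[of "tgt n a"] by (simp add: field_simps)
    qed simp
    then show ?thesis using True w by (simp add: twist_def)
  next
    case False
    then show ?thesis using f by (simp add: twist_def pcarrier_not_walk)
  qed
qed

text \<open>The preimage of an ideal under a ring homomorphism is an ideal, so generators
  suffice.\<close>

lemma H_ideal_twist:
  assumes "\<And>r. r \<in> rels n \<alpha> \<beta> \<Longrightarrow> \<Theta> r \<in> H_ideal n \<alpha>' \<beta>'"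
  shows "f \<in> H_ideal n \<alpha> \<beta> \<Longrightarrow> \<Theta> f \<in> H_ideal n \<alpha>' \<beta>'"
proof -
  interpret ring_hom_ring "path_alg n" "path_alg n" \<Theta>
    by (intro ring_hom_ringI2 ring_path_alg twist_hom)
  have "ideal {r \<in> pcarrier n. \<Theta> r \<in> H_ideal n \<alpha>' \<beta>'} (path_alg n)"
    by (rule ideal_vimage[OF ideal_H_ideal])
  moreover have "rels n \<alpha> \<beta> \<subseteq> {r \<in> pcarrier n. \<Theta> r \<in> H_ideal n \<alpha>' \<beta>'}"
    using assms rels_carrier by blast
  ultimately have "H_ideal n \<alpha> \<beta> \<subseteq> {r \<in> pcarrier n. \<Theta> r \<in> H_ideal n \<alpha>' \<beta>'}"
    by (rule H_ideal_minimal)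
  then show "f \<in> H_ideal n \<alpha> \<beta> \<Longrightarrow> \<Theta> f \<in> H_ideal n \<alpha>' \<beta>'" by blast
qed

text \<open>The first assumption sends the source ideal into the target ideal, the second gives the
  converse through the inverse twist. Together they identify the kernel of
  \<open>?q\<close>.\<close>

lemma H_iso_twist:
  assumes rel: "\<And>r. r \<in> rels n \<alpha> \<beta> \<Longrightarrow> \<exists>c\<noteq>0. \<exists>r'\<in>rels n \<alpha>' \<beta>'. \<Theta> r = (\<lambda>p. c * r' p)"
    and rel': "\<And>r'. r' \<in> rels n \<alpha>' \<beta>' \<Longrightarrow> \<exists>c\<noteq>0. \<exists>r\<in>rels n \<alpha> \<beta>. \<Theta> r = (\<lambda>p. c * r' p)"
  shows "H_iso n \<alpha> \<beta> \<alpha>' \<beta>'"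
proof -
  let ?q = "\<lambda>f. proj n \<alpha>' \<beta>' (\<Theta> f)" and ?\<Theta>' = "twist n \<tau>' \<rho>' (\<lambda>a. inverse (w (\<rho>' a)))"
  interpret inv: quiver_iso n \<tau>' \<tau> \<rho>' \<rho> "\<lambda>a. inverse (w (\<rho>' a))" by (rule inverse)
  have hom: "?q \<in> ring_hom (path_alg n) (H_alg n \<alpha>' \<beta>')"
    using ring_hom_trans[OF twist_hom proj_hom, of \<alpha>' \<beta>'] by (simp add: comp_def)
  interpret q: ring_hom_ring "path_alg n" "H_alg n \<alpha>' \<beta>'" ?q
    by (intro ring_hom_ringI2 ring_path_alg ring_H_alg hom)
  have to: "\<Theta> f \<in> H_ideal n \<alpha>' \<beta>'" if "f \<in> H_ideal n \<alpha> \<beta>" for f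
    using that
  proof (rule H_ideal_twist[rotated])
    fix r assume "r \<in> rels n \<alpha> \<beta>"
    from rel[OF this] obtain c r' where "r' \<in> rels n \<alpha>' \<beta>'" "\<Theta> r = (\<lambda>p. c * r' p)" by blast
    with scale_rel_in_H_ideal[of r' n \<alpha>' \<beta>' c] show "\<Theta> r \<in> H_ideal n \<alpha>' \<beta>'" by simp
  qed
  have from': "?\<Theta>' f \<in> H_ideal n \<alpha> \<beta>" if "f \<in> H_ideal n \<alpha>' \<beta>'" for f
    using that
  proof (rule inv.H_ideal_twist[rotated])
    fix r' assume "r' \<in> rels n \<alpha>' \<beta>'"
    from rel'[OF this] obtain c r where c: "c \<noteq> 0" and r: "r \<in> rels n \<alpha> \<beta>" "\<Theta> r = (\<lambda>p. c * r' p)"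
      by blast
    \<comment> \<open>Rescaling \<open>r\<close> turns its image into \<open>r'\<close> itself, so
      the inverse twist sends \<open>r'\<close> to a multiple of \<open>r\<close>.\<close>
    have "?\<Theta>' (\<lambda>p. inverse c * \<Theta> r p) = (\<lambda>p. inverse c * r p)"
    proof -
      have "r \<in> pcarrier n" using r(1) rels_carrier by blast
      then show ?thesis by (simp add: twist_scale twist_inverse)
    qed
    moreover have "(\<lambda>p. inverse c * \<Theta> r p) = r'" using c by (simp add: r(2) mult.assoc[symmetric])
    ultimately have "?\<Theta>' r' = (\<lambda>p. inverse c * r p)" by simp
    with scale_rel_in_H_ideal[OF r(1), of "inverse c"] show "?\<Theta>' r' \<in> H_ideal n \<alpha> \<beta>" by simp
  qed
  have sub: "H_ideal n a b \<subseteq> pcarrier n" for a b :: "nat \<Rightarrow> 'k"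
    using H_ideal_subset_low_ideal[of n a b] unfolding low_ideal_def by blast
  have zero: "\<zero>\<^bsub>H_alg n \<alpha>' \<beta>'\<^esub> = H_ideal n \<alpha>' \<beta>'" by (simp add: H_alg_def FactRing_def)
  have mem: "proj n \<alpha>' \<beta>' f = H_ideal n \<alpha>' \<beta>' \<longleftrightarrow> f \<in> H_ideal n \<alpha>' \<beta>'" if "f \<in> pcarrier n" for f
    using ring_hom_zero[OF proj_hom ring_path_alg ring_H_alg, of n \<alpha>' \<beta>']
      proj_eq_iff[OF that pcarrier_zero, of \<alpha>' \<beta>'] by (simp add: zero)
  have ker: "a_kernel (path_alg n) (H_alg n \<alpha>' \<beta>') ?q = H_ideal n \<alpha> \<beta>"
  proof -
    have "f \<in> H_ideal n \<alpha> \<beta>" if "f \<in> pcarrier n" "\<Theta> f \<in> H_ideal n \<alpha>' \<beta>'" for f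
      using from'[OF that(2)] twist_inverse[OF that(1)] by simp
    moreover have "f \<in> a_kernel (path_alg n) (H_alg n \<alpha>' \<beta>') ?q
        \<longleftrightarrow> f \<in> pcarrier n \<and> \<Theta> f \<in> H_ideal n \<alpha>' \<beta>'" for f
      unfolding a_kernel_def' zero mem_Collect_eq using mem[OF twist_carrier, of f] by blast
    ultimately show ?thesis using sub to by blast
  qed
  have surj: "?q ` pcarrier n = carrier (H_alg n \<alpha>' \<beta>')"
  proof
    show "?q ` pcarrier n \<subseteq> carrier (H_alg n \<alpha>' \<beta>')" using q.hom_closed by blast
    show "carrier (H_alg n \<alpha>' \<beta>') \<subseteq> ?q ` pcarrier n"
    proof
      fix X assume "X \<in> carrier (H_alg n \<alpha>' \<beta>')"
      then obtain g where g: "g \<in> pcarrier n" "X = proj n \<alpha>' \<beta>' g" using proj_surj by blast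
      have "\<exists>f\<in>pcarrier n. \<Theta> f = g"
        using g(1)
      proof (induction rule: pcarrier_induct)
        case zero
        then show ?case by (intro bexI[of _ "\<lambda>_. 0"]) (auto simp: twist_def)
      next
        case (add g c v as)
        then obtain f where f: "f \<in> pcarrier n" "\<Theta> f = g" by blast
        \<comment> \<open>Dividing by the weight compensates for the factor in
          \<open>twist_bas\<close>.\<close>
        let ?f = "\<lambda>p. f p + (c / prod_list (map w as)) * bas (\<tau> v, map \<rho> as) p"
        have "\<Theta> ?f = (\<lambda>p. \<Theta> f p + (c / prod_list (map w as)) * \<Theta> (bas (\<tau> v, map \<rho> as)) p)"
          by (simp only: twist_add twist_scale)
        then have "\<Theta> ?f = (\<lambda>p. g p + c * bas (v, as) p)"
          using f prod_weight_nonzero[of v as] add by (simp add: twist_bas)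
        moreover have "?f \<in> pcarrier n"
          using f add walk_map by (intro pcarrier_add pcarrier_scale pcarrier_bas) auto
        ultimately show ?case by blast
      qed
      with g show "X \<in> ?q ` pcarrier n" by blast
    qed
  qed
  \<comment> \<open>First isomorphism theorem for \<open>?q\<close>.\<close>
  have "(\<lambda>X. the_elem (?q ` X)) \<in> ring_iso (H_alg n \<alpha> \<beta>) (H_alg n \<alpha>' \<beta>')"
    using q.FactRing_iso_set[OF surj] by (simp add: ker H_alg_def[of n \<alpha> \<beta>])
  moreover have "the_elem (?q ` H_scal n \<alpha> \<beta> c) = H_scal n \<alpha>' \<beta>' c" for c
  proof -
    have "the_elem (?q ` H_scal n \<alpha> \<beta> c) = ?q (pa_const n c)"
      using q.the_elem_simp[of "pa_const n c"] by (simp add: ker H_scal_def)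
    then show ?thesis by (simp add: twist_const H_scal_proj)
  qed
  ultimately show ?thesis unfolding H_iso_def by blast
qed

lemma twist_rel3:
  assumes "walk n u as" "walk n v bs" "walk n x cs"
  shows "\<Theta> (rel3 a b (\<tau> u, map \<rho> as) (\<tau> v, map \<rho> bs) (\<tau> x, map \<rho> cs)) = (\<lambda>p.
    prod_list (map w as) * bas (u, as) p - a * (prod_list (map w bs) * bas (v, bs) p)
     - b * (prod_list (map w cs) * bas (x, cs) p))"
proof -
  have "\<Theta> (rel3 a b p q r) = (\<lambda>x. \<Theta> (bas p) x - a * \<Theta> (bas q) x - b * \<Theta> (bas r) x)" for p q r
    by (auto simp: twist_def rel3_def algebra_simps)
  then show ?thesis using assms by (simp add: twist_bas)
qed

end

section \<open>Explicit isomorphisms for rotations and reflections\<close>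

lemma rotation_iso:
  fixes \<alpha> \<beta> \<alpha>' \<beta>' lam :: "nat \<Rightarrow> 'k::field"
  assumes n: "3 \<le> n" and lam: "\<forall>i<n. lam i \<noteq> 0"
    and eq: "\<forall>i<n. \<alpha>' i = lam (md n (int i + int k)) / lam (md n (int i + int k - 1)) * \<alpha> (md n (int i + int k))
             \<and> \<beta>' i = lam (md n (int i + int k + 1)) / lam (md n (int i + int k - 1)) * \<beta> (md n (int i + int k))"
  shows "H_iso n \<alpha> \<beta> \<alpha>' \<beta>'"
proof -
  define s where "s i = md n (int i + int k)" for i
  define s' where "s' i = md n (int i - int k)" for i
  define \<rho> where "\<rho> a = (case a of U i \<Rightarrow> U (s i) | D i \<Rightarrow> D (s i))" for a
  define \<rho>' where "\<rho>' a = (case a of U i \<Rightarrow> U (s' i) | D i \<Rightarrow> D (s' i))" for a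
  \<comment> \<open>The two arrows of an edge should have weights with product \<open>lam\<close>,
    as in \<open>rotation_case\<close>; the up arrow carries all of it.\<close>
  define w where "w a = (case a of U i \<Rightarrow> lam (s i) | D i \<Rightarrow> 1)" for a
  have sl: "s i < n" "s' i < n" for i using n by (simp_all add: s_def s'_def)
  have inv: "s' (s i) = i" "s (s' i) = i" if "i < n" for i
    using n that by (simp_all add: s_def s'_def)
  have sc: "s (sc n j) = sc n (s j)" and pr: "s (pr n j) = pr n (s j)" for j
    using n by (simp_all add: s_def sc_def pr_def) (simp_all add: algebra_simps)
  interpret quiver_iso n s s' \<rho> \<rho>' w
    by standard (use n lam in \<open>auto simp: sl inv \<rho>_def \<rho>'_def w_def sc split: arr.splits\<close>)
  have coeff: "\<alpha> (s i) * lam (s i) = \<alpha>' i * lam (s (pr n i))"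
     "\<beta> (s i) * lam (s (sc n i)) = \<beta>' i * lam (s (pr n i))" if "i < n" for i
  proof -
    have "md n (int i + int k) = s i" "md n (int i + int k - 1) = s (pr n i)"
      "md n (int i + int k + 1) = s (sc n i)"
      using n by (simp_all add: s_def sc_def pr_def) (simp_all add: algebra_simps)
    then have "\<alpha>' i = lam (s i) / lam (s (pr n i)) * \<alpha> (s i)" "\<beta>' i = lam (s (sc n i)) / lam (s (pr n i)) * \<beta> (s i)"
      using eq that by auto
    then show "\<alpha> (s i) * lam (s i) = \<alpha>' i * lam (s (pr n i))"
     "\<beta> (s i) * lam (s (sc n i)) = \<beta>' i * lam (s (pr n i))"
     using lam sl by simp_all
  qed
  \<comment> \<open>The scalar is the weight of the leading path; \<open>coeff\<close> matches the
    other two terms.\<close>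
  have rel1: "\<Theta> (rel1 n \<alpha> \<beta> (s i)) = (\<lambda>p. lam (s (pr n i)) * lam (s i) * rel1 n \<alpha>' \<beta>' i p)" if i: "i < n" for i
  proof -
    have eq: "rel1 n \<alpha> \<beta> (s i) = rel3 (\<alpha> (s i)) (\<beta> (s i)) (s i, map \<rho> [D (pr n i), U (pr n i), U i])
      (s i, map \<rho> [U i, D i, U i]) (s i, map \<rho> [U i, U (sc n i), D (sc n i)])"
      by (simp add: rel1_rel3 \<rho>_def sc pr)
    have "\<Theta> (rel1 n \<alpha> \<beta> (s i)) = (\<lambda>p. lam (s (pr n i)) * lam (s i) * bas (i, [D (pr n i), U (pr n i), U i]) p
      - (\<alpha> (s i) * lam (s i)) * lam (s i) * bas (i, [U i, D i, U i]) p
      - (\<beta> (s i) * lam (s (sc n i))) * lam (s i) * bas (i, [U i, U (sc n i), D (sc n i)]) p)"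
      unfolding eq using i by (subst twist_rel3) (simp_all add: w_def algebra_simps)
    then show ?thesis unfolding coeff[OF i] by (simp add: rel1_def algebra_simps)
  qed
  have rel2: "\<Theta> (rel2 n \<alpha> \<beta> (s i)) = (\<lambda>p. lam (s (pr n i)) * rel2 n \<alpha>' \<beta>' i p)" if i: "i < n" for i
  proof -
    have eq: "rel2 n \<alpha> \<beta> (s i) = rel3 (\<alpha> (s i)) (\<beta> (s i)) (s (sc n i), map \<rho> [D i, D (pr n i), U (pr n i)])
      (s (sc n i), map \<rho> [D i, U i, D i]) (s (sc n i), map \<rho> [U (sc n i), D (sc n i), D i])"
      by (simp add: rel2_rel3 \<rho>_def sc pr)
    have "\<Theta> (rel2 n \<alpha> \<beta> (s i)) = (\<lambda>p. lam (s (pr n i)) * bas (sc n i, [D i, D (pr n i), U (pr n i)]) p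
      - (\<alpha> (s i) * lam (s i)) * bas (sc n i, [D i, U i, D i]) p
      - (\<beta> (s i) * lam (s (sc n i))) * bas (sc n i, [U (sc n i), D (sc n i), D i]) p)"
      unfolding eq using i by (subst twist_rel3) (simp_all add: w_def algebra_simps)
    then show ?thesis unfolding coeff[OF i] by (simp add: rel2_def algebra_simps)
  qed
  have nz: "lam (s (pr n i)) * lam (s i) \<noteq> 0" "lam (s (pr n i)) \<noteq> 0" for i using lam sl by simp_all
  show ?thesis
  proof (rule H_iso_twist)
    fix r assume "r \<in> rels n \<alpha> \<beta>"
    then obtain j where j: "j < n" "r = rel1 n \<alpha> \<beta> j \<or> r = rel2 n \<alpha> \<beta> j" by blast
    define i where "i = s' j"
    have i: "i < n" "r = rel1 n \<alpha> \<beta> (s i) \<or> r = rel2 n \<alpha> \<beta> (s i)"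
      using j sl inv by (simp_all add: i_def)
    moreover have "rel1 n \<alpha>' \<beta>' i \<in> rels n \<alpha>' \<beta>'" "rel2 n \<alpha>' \<beta>' i \<in> rels n \<alpha>' \<beta>'" using i by auto
    ultimately show "\<exists>c\<noteq>0. \<exists>r'\<in>rels n \<alpha>' \<beta>'. \<Theta> r = (\<lambda>p. c * r' p)"
      using rel1[OF i(1)] rel2[OF i(1)] nz[of i] by blast
  next
    fix r' assume "r' \<in> rels n \<alpha>' \<beta>'"
    then obtain i where i: "i < n" "r' = rel1 n \<alpha>' \<beta>' i \<or> r' = rel2 n \<alpha>' \<beta>' i" by blast
    moreover have "rel1 n \<alpha> \<beta> (s i) \<in> rels n \<alpha> \<beta>" "rel2 n \<alpha> \<beta> (s i) \<in> rels n \<alpha> \<beta>" using sl by auto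
    ultimately show "\<exists>c\<noteq>0. \<exists>r\<in>rels n \<alpha> \<beta>. \<Theta> r = (\<lambda>p. c * r' p)"
      using rel1[OF i(1)] rel2[OF i(1)] nz[of i] by blast
  qed
qed

lemma reflection_iso:
  fixes \<alpha> \<beta> \<alpha>' \<beta>' lam :: "nat \<Rightarrow> 'k::field"
  assumes n: "3 \<le> n" and lam: "\<forall>i<n. lam i \<noteq> 0" and \<beta>: "\<forall>i<n. \<beta> i \<noteq> 0"
    and eq: "\<forall>i<n. \<alpha>' i = - (lam (md n (int n - int i - int k - 1)) * \<alpha> (md n (int n - int i - int k - 1))
                        / (lam (md n (int n - int i - int k)) * \<beta> (md n (int n - int i - int k - 1))))
             \<and> \<beta>' i = lam (md n (int n - int i - int k - 2))
                        / (lam (md n (int n - int i - int k)) * \<beta> (md n (int n - int i - int k - 1)))"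
  shows "H_iso n \<alpha> \<beta> \<alpha>' \<beta>'"
proof -
  define s where "s i = md n (int n - int i - int k)" for i
  define r where "r i = md n (int n - int i - int k - 1)" for i
  define \<rho> where "\<rho> a = (case a of U i \<Rightarrow> D (r i) | D i \<Rightarrow> U (r i))" for a
  \<comment> \<open>\<open>\<rho>\<close> sends \<open>D i\<close> to \<open>U (r i)\<close>, so
    again the source arrow \<open>U j\<close> is the one rescaled by \<open>lam j\<close>.\<close>
  define w where "w a = (case a of U i \<Rightarrow> 1 | D i \<Rightarrow> lam (r i))" for a
  have sl: "s i < n" "r i < n" for i using n by (simp_all add: s_def r_def)
  have s_md: "s (md n x) = md n (int n - x - int k)" and r_md: "r (md n x) = md n (int n - x - int k - 1)" for x
  proof -
    have "s (md n x) = md n (int n - int k - x mod int n)" using n by (simp add: s_def algebra_simps)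
    also have "\<dots> = md n (int n - int k - x)" by (rule md_mod_add)
    finally show "s (md n x) = md n (int n - x - int k)" by (simp add: algebra_simps)
    have "r (md n x) = md n (int n - int k - 1 - x mod int n)" using n by (simp add: r_def algebra_simps)
    also have "\<dots> = md n (int n - int k - 1 - x)" by (rule md_mod_add)
    finally show "r (md n x) = md n (int n - x - int k - 1)" by (simp add: algebra_simps)
  qed
  have inv: "s (s i) = i" "r (r i) = i" if "i < n" for i
    using that s_md[of "int n - int i - int k"] r_md[of "int n - int i - int k - 1"]
    by (simp_all add: s_def[of i] r_def[of i])
  have s_sc: "s (sc n j) = r j" "s j = sc n (r j)"
    and r_sc: "r (sc n j) = pr n (r j)" "r (pr n j) = sc n (r j)" for j
    using n by (simp_all add: sc_def pr_def s_md r_md)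
      (simp_all add: s_def r_def algebra_simps md_diff_self)
  \<comment> \<open>A reflection is an involution and serves as its own inverse.\<close>
  interpret quiver_iso n s s \<rho> \<rho> w
    by standard (use n lam in \<open>auto simp: sl inv \<rho>_def w_def s_sc(1) s_sc(2)[symmetric] split: arr.splits\<close>)
  have coeff: "\<alpha> (r i) * lam (r i) = - \<beta> (r i) * lam (r (pr n i)) * \<alpha>' i"
     "lam (r (sc n i)) = \<beta> (r i) * lam (r (pr n i)) * \<beta>' i" if "i < n" for i
  proof -
    have "md n (int n - int i - int k - 1) = r i" "md n (int n - int i - int k) = r (pr n i)"
      "md n (int n - int i - int k - 2) = r (sc n i)"
      unfolding sc_def pr_def r_md by (simp_all add: r_def algebra_simps)
    then have "\<alpha>' i = - (lam (r i) * \<alpha> (r i) / (lam (r (pr n i)) * \<beta> (r i)))"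
      "\<beta>' i = lam (r (sc n i)) / (lam (r (pr n i)) * \<beta> (r i))"
      using eq that by auto
    then show "\<alpha> (r i) * lam (r i) = - \<beta> (r i) * lam (r (pr n i)) * \<alpha>' i"
     "lam (r (sc n i)) = \<beta> (r i) * lam (r (pr n i)) * \<beta>' i"
     using lam \<beta> sl by (simp_all add: field_simps)
  qed
  \<comment> \<open>The leading term of the target relation comes from the \<open>\<beta>\<close>
    term of the source relation. Its coefficient is therefore the normalising scalar, nonzero
    because \<open>\<beta>\<close> is.\<close>
  define c where "c i = - \<beta> (r i) * lam (r (pr n i))" for i
  have rel1: "\<Theta> (rel1 n \<alpha> \<beta> (r i)) = (\<lambda>p. c i * lam (r i) * rel2 n \<alpha>' \<beta>' i p)" if i: "i < n" for i
  proof -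
    have eq: "rel1 n \<alpha> \<beta> (r i) = rel3 (\<alpha> (r i)) (\<beta> (r i)) (s (sc n i), map \<rho> [U (sc n i), D (sc n i), D i])
      (s (sc n i), map \<rho> [D i, U i, D i]) (s (sc n i), map \<rho> [D i, D (pr n i), U (pr n i)])"
      by (simp add: rel1_rel3 \<rho>_def s_sc r_sc sl)
    have "\<Theta> (rel1 n \<alpha> \<beta> (r i)) = (\<lambda>p. lam (r (sc n i)) * lam (r i) * bas (sc n i, [U (sc n i), D (sc n i), D i]) p
      - (\<alpha> (r i) * lam (r i)) * lam (r i) * bas (sc n i, [D i, U i, D i]) p
      - \<beta> (r i) * lam (r (pr n i)) * lam (r i) * bas (sc n i, [D i, D (pr n i), U (pr n i)]) p)"
      unfolding eq using i by (subst twist_rel3) (simp_all add: w_def algebra_simps)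
    then show ?thesis unfolding coeff[OF i] by (simp add: rel2_def c_def algebra_simps)
  qed
  have rel2: "\<Theta> (rel2 n \<alpha> \<beta> (r i)) = (\<lambda>p. c i * rel1 n \<alpha>' \<beta>' i p)" if i: "i < n" for i
  proof -
    have eq: "rel2 n \<alpha> \<beta> (r i) = rel3 (\<alpha> (r i)) (\<beta> (r i)) (s i, map \<rho> [U i, U (sc n i), D (sc n i)])
      (s i, map \<rho> [U i, D i, U i]) (s i, map \<rho> [D (pr n i), U (pr n i), U i])"
      by (simp add: rel2_rel3 \<rho>_def s_sc(2) r_sc)
    have "\<Theta> (rel2 n \<alpha> \<beta> (r i)) = (\<lambda>p. lam (r (sc n i)) * bas (i, [U i, U (sc n i), D (sc n i)]) p
      - (\<alpha> (r i) * lam (r i)) * bas (i, [U i, D i, U i]) p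
      - \<beta> (r i) * lam (r (pr n i)) * bas (i, [D (pr n i), U (pr n i), U i]) p)"
      unfolding eq using i by (subst twist_rel3) (simp_all add: w_def algebra_simps)
    then show ?thesis unfolding coeff[OF i] by (simp add: rel1_def c_def algebra_simps)
  qed
  have nz: "c i * lam (r i) \<noteq> 0" "c i \<noteq> 0" for i using lam \<beta> sl by (simp_all add: c_def)
  show ?thesis
  proof (rule H_iso_twist)
    fix x assume "x \<in> rels n \<alpha> \<beta>"
    then obtain j where j: "j < n" "x = rel1 n \<alpha> \<beta> j \<or> x = rel2 n \<alpha> \<beta> j" by blast
    define i where "i = r j"
    have i: "i < n" "x = rel1 n \<alpha> \<beta> (r i) \<or> x = rel2 n \<alpha> \<beta> (r i)"
      using j sl inv by (simp_all add: i_def)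
    moreover have "rel1 n \<alpha>' \<beta>' i \<in> rels n \<alpha>' \<beta>'" "rel2 n \<alpha>' \<beta>' i \<in> rels n \<alpha>' \<beta>'" using i by auto
    ultimately show "\<exists>c\<noteq>0. \<exists>r'\<in>rels n \<alpha>' \<beta>'. \<Theta> x = (\<lambda>p. c * r' p)"
      using rel1[OF i(1)] rel2[OF i(1)] nz[of i] by blast
  next
    fix r' assume "r' \<in> rels n \<alpha>' \<beta>'"
    then obtain i where i: "i < n" "r' = rel1 n \<alpha>' \<beta>' i \<or> r' = rel2 n \<alpha>' \<beta>' i" by blast
    moreover have "rel1 n \<alpha> \<beta> (r i) \<in> rels n \<alpha> \<beta>" "rel2 n \<alpha> \<beta> (r i) \<in> rels n \<alpha> \<beta>" using sl by auto
    ultimately show "\<exists>c\<noteq>0. \<exists>r\<in>rels n \<alpha> \<beta>. \<Theta> r = (\<lambda>p. c * r' p)"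
      using rel1[OF i(1)] rel2[OF i(1)] nz[of i] by blast
  qed
qed

section \<open>The classification up to isomorphism\<close>

theorem theorem5p2:
  fixes n :: nat and \<alpha> \<beta> \<alpha>' \<beta>' :: "nat \<Rightarrow> 'k::field_char_0"
  assumes alg_closed: "\<And>p :: 'k poly. degree p > 0 \<Longrightarrow> \<exists>x. poly p x = 0"
    and n3: "n \<ge> 3"
    and \<beta>_nz: "\<forall>i<n. \<beta> i \<noteq> 0" and \<beta>'_nz: "\<forall>i<n. \<beta>' i \<noteq> 0"
  shows "H_iso n \<alpha> \<beta> \<alpha>' \<beta>' \<longleftrightarrow>
    (\<exists>lam :: nat \<Rightarrow> 'k. \<exists>k<n. (\<forall>i<n. lam i \<noteq> 0) \<and>
      ((\<forall>i<n. \<alpha>' i = lam (md n (int i + int k)) / lam (md n (int i + int k - 1)) * \<alpha> (md n (int i + int k))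
             \<and> \<beta>' i = lam (md n (int i + int k + 1)) / lam (md n (int i + int k - 1)) * \<beta> (md n (int i + int k)))
     \<or> (\<forall>i<n. \<alpha>' i = - (lam (md n (int n - int i - int k - 1)) * \<alpha> (md n (int n - int i - int k - 1))
                        / (lam (md n (int n - int i - int k)) * \<beta> (md n (int n - int i - int k - 1))))
             \<and> \<beta>' i = lam (md n (int n - int i - int k - 2))
                        / (lam (md n (int n - int i - int k)) * \<beta> (md n (int n - int i - int k - 1))))))"
    (is "_ \<longleftrightarrow> (\<exists>lam. \<exists>k<n. _ lam \<and> (?rot lam k \<or> ?ref lam k))")
proof
  assume "H_iso n \<alpha> \<beta> \<alpha>' \<beta>'"
  then obtain \<phi> where "\<phi> \<in> ring_iso (H_alg n \<alpha> \<beta>) (H_alg n \<alpha>' \<beta>')"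
    and "\<And>c. \<phi> (H_scal n \<alpha> \<beta> c) = H_scal n \<alpha>' \<beta>' c"
    unfolding H_iso_def by blast
  then interpret H_isomorphism n \<alpha> \<beta> \<alpha>' \<beta>' \<phi> using n3 by unfold_locales
  obtain k where k: "k < n"
    and dih: "(\<forall>j<n. sigma j = md n (int j + int k)) \<or> (\<forall>j<n. sigma j = md n (int n - int j - int k))"
    using sigma_dihedral by blast
  from dih show "\<exists>lam. \<exists>k<n. (\<forall>i<n. lam i \<noteq> 0) \<and> (?rot lam k \<or> ?ref lam k)"
  proof
    assume "\<forall>j<n. sigma j = md n (int j + int k)"
    with rotation_case k show ?thesis by blast
  next
    assume "\<forall>j<n. sigma j = md n (int n - int j - int k)"
    with reflection_case k show ?thesis by blast
  qed
next
  assume "\<exists>lam. \<exists>k<n. (\<forall>i<n. lam i \<noteq> 0) \<and> (?rot lam k \<or> ?ref lam k)"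
  then obtain lam k where lam: "\<forall>i<n. lam i \<noteq> 0" and eq: "?rot lam k \<or> ?ref lam k"
    by blast
  from eq show "H_iso n \<alpha> \<beta> \<alpha>' \<beta>'"
  proof
    assume "?rot lam k"
    with n3 lam show ?thesis by (rule rotation_iso)
  next
    assume "?ref lam k"
    with n3 lam \<beta>_nz show ?thesis by (rule reflection_iso)
  qed
qed

end
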